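(* Let $S$ be a recurrent specular set on the finite alphabet $A$ relative to the involution $\theta$, and let $X\subset S$ be a finite symmetric bifix code. Let $d\ge 1$ be an integer. Then $X$ is an $S$-maximal bifix code of $S$-degree $d$ if and only if $X$ is a monoidal basis of a subgroup of index $d$ of $G_\theta$.
   Context: Words are over a finite alphabet $A$; $\varepsilon$ is the empty word. A set $S$ of words on $A$ is factorial if it contains $A$ and all the factors of its elements. For $w\in S$ let $L(w)=\{a\in A\mid aw\in S\}$, $R(w)=\{a\in A\mid wa\in S\}$, $B(w)=\{(a,b)\in A\times A\mid awb\in S\}$. A factorial set $S$ is biextendable if $B(w)\neq\emptyset$ for all $w\in S$. The extension graph $\mathcal{E}(w)$ is the undirected graph whose vertex set is the disjoint union of $L(w)$ and $R(w)$ and whose edges are the pairs in $B(w)$. A biextendable set $S$ is a tree set of characteristic $c$ if $\mathcal{E}(w)$ is a tree for every nonempty $w\in S$ and $\mathcal{E}(\varepsilon)$ is a disjoint union of $c$ trees. Let $\theta$ be an involution on $A$ (possibly with fixed points) and let $G_\theta$ be the group generated by $A$ with relations $a\theta(a)=1$, $a\in A$ (so $a^{-1}=\theta(a)$). A word is reduced if it has no factor $a\theta(a)$ with $a\in A$; every element of $G_\theta$ is represented by a unique reduced word, and reduced words are identified with elements of $G_\theta$. A laminary set on $A$ relative to $\theta$ is a biextendable set of reduced words closed under taking inverses. A specular set is a laminary set which is a tree set of characteristic $2$. A set $S\ne\{\varepsilon\}$ is recurrent if it is factorial and for all $u,w\in S$ there is $v\in S$ with $uvw\in S$. A bifix code is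 a set of nonempty words in which no element is a proper prefix or a proper suffix of another. A bifix code $X\subset S$ is $S$-maximal if it is not properly contained in a bifix code $Y\subset S$. A parse of a word $w$ with respect to $X$ is a triple $(q,x,p)$ with $w=qxp$, where $q$ has no suffix in $X$, $x\in X^*$ and $p$ has no prefix in $X$. The $S$-degree of $X$ is the maximal number of parses with respect to $X$ of a word of $S$. A subset $X$ of a group is symmetric if it is closed under taking inverses. A set $X$ is a monoidal basis of a group $H$ if $X\subset H$ is symmetric, the monoid generated by $X$ is $H$, and any product $x_1x_2\cdots x_m$ ($m\ge1$) of elements of $X$ such that $x_kx_{k+1}\neq 1$ for $1\le k\le m-1$ is different from $1$. *)

theory Defs
  imports "HOL-Library.Sublist" "HOL-Library.Disjoint_Sets" "HOL-Algebra.Coset"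
begin

text \<open>Words are lists, and an alphabet is an explicit set \<open>A\<close> of letters.\<close>

text \<open>An undirected graph is a vertex set \<open>V\<close> with a set \<open>E\<close> of unordered pairs of vertices.\<close>

definition ugraph_walk :: "'v set \<Rightarrow> 'v set set \<Rightarrow> 'v list \<Rightarrow> bool" where
  "ugraph_walk V E p \<longleftrightarrow> p \<noteq> [] \<and> set p \<subseteq> V \<and> successively (\<lambda>x y. {x, y} \<in> E) p"

definition ugraph_connected :: "'v set \<Rightarrow> 'v set set \<Rightarrow> bool" where
  "ugraph_connected V E \<longleftrightarrow>
     (\<forall>u\<in>V. \<forall>v\<in>V. \<exists>p. ugraph_walk V E p \<and> hd p = u \<and> last p = v)"

definition ugraph_cycle :: "'v set \<Rightarrow> 'v set set \<Rightarrow> 'v list \<Rightarrow> bool" where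
  "ugraph_cycle V E p \<longleftrightarrow>
     ugraph_walk V E p \<and> distinct p \<and> length p \<ge> 3 \<and> {last p, hd p} \<in> E"

definition ugraph_tree :: "'v set \<Rightarrow> 'v set set \<Rightarrow> bool" where
  "ugraph_tree V E \<longleftrightarrow> V \<noteq> {} \<and> ugraph_connected V E \<and> (\<nexists>p. ugraph_cycle V E p)"

definition disjoint_union_of_trees :: "nat \<Rightarrow> 'v set \<Rightarrow> 'v set set \<Rightarrow> bool" where
  "disjoint_union_of_trees c V E \<longleftrightarrow>
     (\<exists>P. partition_on V P \<and> finite P \<and> card P = c \<and>
          (\<forall>e\<in>E. \<exists>C\<in>P. e \<subseteq> C) \<and>
          (\<forall>C\<in>P. ugraph_tree C {e\<in>E. e \<subseteq> C}))"

definition factorial_set :: "'a set \<Rightarrow> 'a list set \<Rightarrow> bool" where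
  "factorial_set A S \<longleftrightarrow>
     S \<subseteq> lists A \<and> (\<forall>a\<in>A. [a] \<in> S) \<and> (\<forall>w\<in>S. \<forall>v. sublist v w \<longrightarrow> v \<in> S)"

definition left_ext :: "'a set \<Rightarrow> 'a list set \<Rightarrow> 'a list \<Rightarrow> 'a set" where
  "left_ext A S w = {a\<in>A. a # w \<in> S}"

definition right_ext :: "'a set \<Rightarrow> 'a list set \<Rightarrow> 'a list \<Rightarrow> 'a set" where
  "right_ext A S w = {a\<in>A. w @ [a] \<in> S}"

definition bi_ext :: "'a set \<Rightarrow> 'a list set \<Rightarrow> 'a list \<Rightarrow> ('a \<times> 'a) set" where
  "bi_ext A S w = {(a, b) \<in> A \<times> A. a # w @ [b] \<in> S}"

definition biextendable :: "'a set \<Rightarrow> 'a list set \<Rightarrow> bool" where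
  "biextendable A S \<longleftrightarrow> factorial_set A S \<and> (\<forall>w\<in>S. bi_ext A S w \<noteq> {})"

definition ext_vertices :: "'a set \<Rightarrow> 'a list set \<Rightarrow> 'a list \<Rightarrow> ('a + 'a) set" where
  "ext_vertices A S w = left_ext A S w <+> right_ext A S w"

definition ext_edges :: "'a set \<Rightarrow> 'a list set \<Rightarrow> 'a list \<Rightarrow> ('a + 'a) set set" where
  "ext_edges A S w = {{Inl a, Inr b} | a b. (a, b) \<in> bi_ext A S w}"

definition tree_set :: "'a set \<Rightarrow> nat \<Rightarrow> 'a list set \<Rightarrow> bool" where
  "tree_set A c S \<longleftrightarrow> biextendable A S \<and>
     (\<forall>w\<in>S. w \<noteq> [] \<longrightarrow> ugraph_tree (ext_vertices A S w) (ext_edges A S w)) \<and>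
     disjoint_union_of_trees c (ext_vertices A S []) (ext_edges A S [])"

definition recurrent_set :: "'a set \<Rightarrow> 'a list set \<Rightarrow> bool" where
  "recurrent_set A S \<longleftrightarrow>
     S \<noteq> {[]} \<and> factorial_set A S \<and> (\<forall>u\<in>S. \<forall>w\<in>S. \<exists>v\<in>S. u @ v @ w \<in> S)"

definition involution_on :: "'a set \<Rightarrow> ('a \<Rightarrow> 'a) \<Rightarrow> bool" where
  "involution_on A \<theta> \<longleftrightarrow> (\<forall>a\<in>A. \<theta> a \<in> A \<and> \<theta> (\<theta> a) = a)"

definition reduced :: "'a set \<Rightarrow> ('a \<Rightarrow> 'a) \<Rightarrow> 'a list \<Rightarrow> bool" where
  "reduced A \<theta> w \<longleftrightarrow> w \<in> lists A \<and> (\<forall>a\<in>A. \<not> sublist [a, \<theta> a] w)"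

text \<open>The inverse on the level of words: \<open>(a\<^sub>1 \<dots> a\<^sub>n)\<inverse> = \<theta>(a\<^sub>n) \<dots> \<theta>(a\<^sub>1)\<close>. It maps reduced words
  to reduced words and represents the inverse in the group (lemma \<open>inv_elt\<close> below).\<close>

definition word_inv :: "('a \<Rightarrow> 'a) \<Rightarrow> 'a list \<Rightarrow> 'a list" where
  "word_inv \<theta> w = rev (map \<theta> w)"

definition symmetric_words :: "('a \<Rightarrow> 'a) \<Rightarrow> 'a list set \<Rightarrow> bool" where
  "symmetric_words \<theta> X \<longleftrightarrow> (\<forall>w\<in>X. word_inv \<theta> w \<in> X)"

definition laminary :: "'a set \<Rightarrow> ('a \<Rightarrow> 'a) \<Rightarrow> 'a list set \<Rightarrow> bool" where
  "laminary A \<theta> S \<longleftrightarrow> biextendable A S \<and> (\<forall>w\<in>S. reduced A \<theta> w) \<and> symmetric_words \<theta> S"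

definition specular :: "'a set \<Rightarrow> ('a \<Rightarrow> 'a) \<Rightarrow> 'a list set \<Rightarrow> bool" where
  "specular A \<theta> S \<longleftrightarrow> laminary A \<theta> S \<and> tree_set A 2 S"

definition bifix_code :: "'a list set \<Rightarrow> bool" where
  "bifix_code X \<longleftrightarrow> [] \<notin> X \<and> (\<forall>x\<in>X. \<forall>y\<in>X. \<not> strict_prefix x y \<and> \<not> strict_suffix x y)"

definition maximal_bifix_code :: "'a list set \<Rightarrow> 'a list set \<Rightarrow> bool" where
  "maximal_bifix_code S X \<longleftrightarrow>
     bifix_code X \<and> X \<subseteq> S \<and> (\<forall>Y. bifix_code Y \<and> Y \<subseteq> S \<longrightarrow> \<not> X \<subset> Y)"

definition word_star :: "'a list set \<Rightarrow> 'a list set" where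
  "word_star X = concat ` lists X"

definition parses :: "'a list set \<Rightarrow> 'a list \<Rightarrow> ('a list \<times> 'a list \<times> 'a list) set" where
  "parses X w = {(q, x, p). w = q @ x @ p \<and> (\<forall>u\<in>X. \<not> suffix u q) \<and> x \<in> word_star X \<and>
                            (\<forall>u\<in>X. \<not> prefix u p)}"

text \<open>The \<open>S\<close>-degree is a maximum, which need not exist; the predicate says that it exists and
  equals \<open>d\<close>. Every word has finitely many parses, so \<open>card\<close> is the actual number of parses.\<close>

definition has_degree :: "'a list set \<Rightarrow> 'a list set \<Rightarrow> nat \<Rightarrow> bool" where
  "has_degree S X d \<longleftrightarrow>
     (\<forall>w\<in>S. card (parses X w) \<le> d) \<and> (\<exists>w\<in>S. card (parses X w) = d)"

lemma finite_parses: "finite (parses X w)"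
proof (rule finite_subset)
  let ?F = "{v. sublist v w}"
  show "parses X w \<subseteq> ?F \<times> ?F \<times> ?F"
  proof safe
    fix q x p assume "(q, x, p) \<in> parses X w"
    then have w: "w = q @ x @ p" by (simp add: parses_def)
    show "sublist q w" unfolding w by (rule sublist_append_rightI)
    show "sublist x w" unfolding w by (rule sublist_appendI)
    show "sublist p w" unfolding w using sublist_append_leftI[of p "q @ x"] by simp
  qed
  have "?F = set (sublists w)" by (simp add: set_sublists_eq)
  then show "finite (?F \<times> ?F \<times> ?F)" by simp
qed

text \<open>As \<open>\<theta>\<close> is an involution, the relations make every generator invertible already in the
  monoid with this presentation, so the group is the quotient of the free monoid \<open>lists A\<close> by the
  congruence generated by the relations. Lemmas
  \<open>group_G_theta\<close>, \<open>elt_eq_list_prod\<close> and \<open>G_theta_universal\<close> confirm this.\<close>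

inductive word_cong :: "'a set \<Rightarrow> ('a \<Rightarrow> 'a) \<Rightarrow> 'a list \<Rightarrow> 'a list \<Rightarrow> bool"
  for A :: "'a set" and \<theta> :: "'a \<Rightarrow> 'a" where
  rel: "a \<in> A \<Longrightarrow> word_cong A \<theta> [a, \<theta> a] []"
| refl: "w \<in> lists A \<Longrightarrow> word_cong A \<theta> w w"
| sym: "word_cong A \<theta> u v \<Longrightarrow> word_cong A \<theta> v u"
| trans: "word_cong A \<theta> u v \<Longrightarrow> word_cong A \<theta> v w \<Longrightarrow> word_cong A \<theta> u w"
| append: "word_cong A \<theta> u u' \<Longrightarrow> word_cong A \<theta> v v' \<Longrightarrow> word_cong A \<theta> (u @ v) (u' @ v')"

definition elt :: "'a set \<Rightarrow> ('a \<Rightarrow> 'a) \<Rightarrow> 'a list \<Rightarrow> 'a list set" where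
  "elt A \<theta> w = {v. word_cong A \<theta> w v}"

definition G_theta :: "'a set \<Rightarrow> ('a \<Rightarrow> 'a) \<Rightarrow> 'a list set monoid" where
  "G_theta A \<theta> =
     \<lparr>carrier = elt A \<theta> ` lists A,
      mult = (\<lambda>C D. \<Union>u\<in>C. \<Union>v\<in>D. elt A \<theta> (u @ v)),
      one = elt A \<theta> []\<rparr>"

lemma elt_eqI: "word_cong A \<theta> u v \<Longrightarrow> elt A \<theta> u = elt A \<theta> v"
  unfolding elt_def by (blast intro: word_cong.sym word_cong.trans)

lemma elt_eq_iff: "v \<in> lists A \<Longrightarrow> elt A \<theta> u = elt A \<theta> v \<longleftrightarrow> word_cong A \<theta> u v"
  using elt_eqI[of A \<theta> u v] word_cong.refl[of v A \<theta>] by (auto simp: elt_def)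

lemma mult_elt:
  assumes "u \<in> lists A" "v \<in> lists A"
  shows "elt A \<theta> u \<otimes>\<^bsub>G_theta A \<theta>\<^esub> elt A \<theta> v = elt A \<theta> (u @ v)"
proof -
  let ?E = "elt A \<theta>"
  have eq: "?E (u' @ v') = ?E (u @ v)" if "u' \<in> ?E u" "v' \<in> ?E v" for u' v'
    using that by (intro elt_eqI[symmetric] word_cong.append) (simp_all add: elt_def)
  have ne: "?E u \<noteq> {}" "?E v \<noteq> {}"
    using word_cong.refl[OF assms(1)] word_cong.refl[OF assms(2)] unfolding elt_def by blast+
  have "(\<Union>u'\<in>?E u. \<Union>v'\<in>?E v. ?E (u' @ v')) = (\<Union>u'\<in>?E u. \<Union>v'\<in>?E v. ?E (u @ v))"
    by (intro SUP_cong HOL.refl eq)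
  then show ?thesis using ne by (simp add: G_theta_def)
qed

lemma elt_carrier: "w \<in> lists A \<Longrightarrow> elt A \<theta> w \<in> carrier (G_theta A \<theta>)"
  by (simp add: G_theta_def)

lemma one_elt: "\<one>\<^bsub>G_theta A \<theta>\<^esub> = elt A \<theta> []"
  by (simp add: G_theta_def)

lemma word_inv_lists: "involution_on A \<theta> \<Longrightarrow> w \<in> lists A \<Longrightarrow> word_inv \<theta> w \<in> lists A"
  by (auto simp: word_inv_def involution_on_def)

lemma word_cong_inv:
  assumes "involution_on A \<theta>" "w \<in> lists A"
  shows "word_cong A \<theta> (word_inv \<theta> w @ w) []"
  using assms(2)
proof (induction w)
  case Nil
  then show ?case by (simp add: word_inv_def word_cong.refl)
next
  case (Cons a w)
  then have a: "\<theta> a \<in> A" "\<theta> (\<theta> a) = a" and w: "w \<in> lists A"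
    using assms(1) by (auto simp: involution_on_def)
  have "word_cong A \<theta> ([\<theta> a, a] @ w) ([] @ w)"
    using word_cong.rel[OF a(1), of \<theta>] a(2) w
    by (intro word_cong.append word_cong.refl) simp_all
  then have "word_cong A \<theta> (word_inv \<theta> w @ [\<theta> a, a] @ w) (word_inv \<theta> w @ [] @ w)"
    using word_inv_lists[OF assms(1) w] by (intro word_cong.append[OF word_cong.refl])
  then have "word_cong A \<theta> (word_inv \<theta> (a # w) @ a # w) (word_inv \<theta> w @ w)"
    by (simp add: word_inv_def)
  then show ?case using Cons.IH w by (blast intro: word_cong.trans)
qed

lemma group_G_theta:
  assumes "involution_on A \<theta>"
  shows "group (G_theta A \<theta>)"
proof (rule groupI)
  fix x assume "x \<in> carrier (G_theta A \<theta>)"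
  then obtain u where u: "x = elt A \<theta> u" "u \<in> lists A" by (auto simp: G_theta_def)
  show "\<one>\<^bsub>G_theta A \<theta>\<^esub> \<otimes>\<^bsub>G_theta A \<theta>\<^esub> x = x" by (simp add: one_elt u mult_elt)
  show "\<exists>y\<in>carrier (G_theta A \<theta>). y \<otimes>\<^bsub>G_theta A \<theta>\<^esub> x = \<one>\<^bsub>G_theta A \<theta>\<^esub>"
    using u word_inv_lists[OF assms] elt_eqI[OF word_cong_inv[OF assms u(2)]]
    by (intro bexI[of _ "elt A \<theta> (word_inv \<theta> u)"]) (auto simp: one_elt mult_elt elt_carrier)
next
  fix x y assume "x \<in> carrier (G_theta A \<theta>)" "y \<in> carrier (G_theta A \<theta>)"
  then obtain u v where uv: "x = elt A \<theta> u" "u \<in> lists A" "y = elt A \<theta> v" "v \<in> lists A"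
    by (auto simp: G_theta_def)
  then show "x \<otimes>\<^bsub>G_theta A \<theta>\<^esub> y \<in> carrier (G_theta A \<theta>)" by (simp add: mult_elt elt_carrier)
  fix z assume "z \<in> carrier (G_theta A \<theta>)"
  then obtain w where w: "z = elt A \<theta> w" "w \<in> lists A" by (auto simp: G_theta_def)
  have l: "u @ v \<in> lists A" "v @ w \<in> lists A" using uv w by auto
  show "x \<otimes>\<^bsub>G_theta A \<theta>\<^esub> y \<otimes>\<^bsub>G_theta A \<theta>\<^esub> z = x \<otimes>\<^bsub>G_theta A \<theta>\<^esub> (y \<otimes>\<^bsub>G_theta A \<theta>\<^esub> z)"
    using uv(2,4) w(2) l by (simp only: uv w mult_elt append.assoc)
qed (simp add: one_elt elt_carrier)

lemma inv_elt:
  assumes "involution_on A \<theta>" "w \<in> lists A"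
  shows "inv\<^bsub>G_theta A \<theta>\<^esub> (elt A \<theta> w) = elt A \<theta> (word_inv \<theta> w)"
proof (rule group.inv_equality[OF group_G_theta[OF assms(1)]])
  show "elt A \<theta> (word_inv \<theta> w) \<otimes>\<^bsub>G_theta A \<theta>\<^esub> elt A \<theta> w = \<one>\<^bsub>G_theta A \<theta>\<^esub>"
    using assms by (simp add: mult_elt word_inv_lists one_elt elt_eqI word_cong_inv)
qed (use assms in \<open>simp_all add: elt_carrier word_inv_lists\<close>)

definition list_prod :: "('g, 'm) monoid_scheme \<Rightarrow> 'g list \<Rightarrow> 'g" where
  "list_prod G xs = foldr (\<lambda>x y. x \<otimes>\<^bsub>G\<^esub> y) xs \<one>\<^bsub>G\<^esub>"

lemma elt_eq_list_prod:
  "w \<in> lists A \<Longrightarrow> elt A \<theta> w = list_prod (G_theta A \<theta>) (map (\<lambda>a. elt A \<theta> [a]) w)"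
proof (induction w)
  case (Cons a w)
  then show ?case using mult_elt[of "[a]" A w \<theta>] by (simp add: list_prod_def)
qed (simp add: list_prod_def one_elt)

lemma G_theta_universal:
  assumes K: "group K" and f: "f \<in> A \<rightarrow> carrier K"
    and rel: "\<And>a. a \<in> A \<Longrightarrow> \<theta> a \<in> A \<and> f a \<otimes>\<^bsub>K\<^esub> f (\<theta> a) = \<one>\<^bsub>K\<^esub>"
  shows "\<exists>h\<in>hom (G_theta A \<theta>) K. \<forall>a\<in>A. h (elt A \<theta> [a]) = f a"
proof -
  interpret K: group K by (rule K)
  let ?p = "\<lambda>w. list_prod K (map f w)"
  have closed: "?p w \<in> carrier K" if "w \<in> lists A" for w
    using that f by (induction w) (auto simp: list_prod_def)
  have app: "?p (u @ v) = ?p u \<otimes>\<^bsub>K\<^esub> ?p v" if "u \<in> lists A" "v \<in> lists A" for u v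
    using that
  proof (induction u)
    case Nil
    then show ?case using closed[of v] by (simp add: list_prod_def)
  next
    case (Cons a u)
    then show ?case using closed[of u] closed[of v] f
      by (auto simp: list_prod_def K.m_assoc Pi_iff)
  qed
  have cong: "u \<in> lists A \<and> v \<in> lists A \<and> ?p u = ?p v" if "word_cong A \<theta> u v" for u v
    using that
  proof (induction rule: word_cong.induct)
    case (rel a)
    then show ?case using assms(3)[of a] f by (auto simp: list_prod_def Pi_iff)
  next
    case (append u u' v v')
    then show ?case using app by simp
  qed auto
  define h where "h C = ?p (SOME w. w \<in> C)" for C
  have h: "h (elt A \<theta> w) = ?p w" if "w \<in> lists A" for w
  proof -
    have "w \<in> elt A \<theta> w" using that by (simp add: elt_def word_cong.refl)
    then have "(SOME v. v \<in> elt A \<theta> w) \<in> elt A \<theta> w" by (rule someI)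
    then show ?thesis using cong by (simp add: elt_def h_def)
  qed
  have "h \<in> hom (G_theta A \<theta>) K"
  proof (rule homI)
    fix x y assume "x \<in> carrier (G_theta A \<theta>)" "y \<in> carrier (G_theta A \<theta>)"
    then obtain u v where uv: "x = elt A \<theta> u" "u \<in> lists A" "y = elt A \<theta> v" "v \<in> lists A"
      by (auto simp: G_theta_def)
    then have "u @ v \<in> lists A" by auto
    then show "h (x \<otimes>\<^bsub>G_theta A \<theta>\<^esub> y) = h x \<otimes>\<^bsub>K\<^esub> h y"
      using uv(2,4) by (simp only: uv mult_elt h app)
  next
    fix x assume "x \<in> carrier (G_theta A \<theta>)"
    then obtain u where "x = elt A \<theta> u" "u \<in> lists A" unfolding G_theta_def by auto
    then show "h x \<in> carrier K" by (simp only: h closed)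
  qed
  moreover have "h (elt A \<theta> [a]) = f a" if "a \<in> A" for a
    using h[of "[a]"] that f by (auto simp: list_prod_def Pi_iff)
  ultimately show ?thesis by blast
qed

definition monoidal_basis :: "('g, 'm) monoid_scheme \<Rightarrow> 'g set \<Rightarrow> 'g set \<Rightarrow> bool" where
  "monoidal_basis G H X \<longleftrightarrow>
     X \<subseteq> H \<and> (\<forall>x\<in>X. inv\<^bsub>G\<^esub> x \<in> X) \<and>
     list_prod G ` lists X = H \<and>
     (\<forall>xs\<in>lists X. xs \<noteq> [] \<and> (\<forall>k. Suc k < length xs \<longrightarrow> xs ! k \<otimes>\<^bsub>G\<^esub> xs ! Suc k \<noteq> \<one>\<^bsub>G\<^esub>)
        \<longrightarrow> list_prod G xs \<noteq> \<one>\<^bsub>G\<^esub>)"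

end

theory Submission
  imports Defs
begin

text \<open>Label the edges of a finite graph by elements of a group. If the graph is acyclic, there is a
  potential on the vertices with these differences; if it is connected, the potential is unique up to
  a constant. Both properties pass from the extension graphs of letters to those of words of length
  \<open>N\<close> on either side of a word \<open>w\<close> of a tree set. Hence a group-valued function of the window of the
  last \<open>N\<close> letters and the next letter is cohomologous to one that depends on the next letter only.

  For a symmetric bifix code \<open>X\<close> this is applied to the automaton that parses words of \<open>S\<close> over \<open>X\<close>
  and stores the reduced product of the code words read so far. It yields an action of \<open>G\<^sub>\<theta>\<close> from
  which one reads off that \<open>\<langle>X\<rangle> \<inter> S = X\<^sup>* \<inter> S\<close> and that \<open>X\<close> is a monoidal basis of \<open>H = \<langle>X\<rangle>\<close>.
  It remains to compare degree and index. If the index is finite, then every word of \<open>S\<close> is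
  prefix-comparable with \<open>X\<close>. If this holds, let \<open>c(u)\<close> be the set of cosets \<open>H q\<close>, for the suffixes \<open>q\<close>
  of \<open>u\<close> without prefix in \<open>X\<close>. These cosets are distinct, and there are as many as parses of \<open>u\<close>.
  For long \<open>u\<close> and \<open>v\<close> with \<open>u v \<in> S\<close> one has \<open>c(u) = c(v\<inverse>)\<close>, so by connectedness \<open>c(u)\<close> does not
  depend on \<open>u\<close>; it is therefore stable under \<open>G\<^sub>\<theta>\<close> and consists of all cosets.\<close>

section \<open>Potentials on extension graphs\<close>

lemma bij_ident [simp]: "bij (\<lambda>x. x)"
  using bij_id by (simp add: id_def)

abbreviation finv :: "('a \<Rightarrow> 'b) \<Rightarrow> 'b \<Rightarrow> 'a" where "finv \<equiv> inv_into UNIV"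

text \<open>Distinctness lets the path close up to a cycle in \<open>acyclic_potential\<close>. A
  step back to a visited vertex cuts the path there.\<close>

lemma rtrancl_simple_path:
  assumes "(x, y) \<in> R\<^sup>*"
  shows "\<exists>p. p \<noteq> [] \<and> hd p = x \<and> last p = y \<and> distinct p \<and> successively (\<lambda>u v. (u, v) \<in> R) p"
  using assms
proof (induction rule: rtrancl_induct)
  case base
  show ?case by (intro exI[of _ "[x]"]) simp
next
  case (step y z)
  then obtain p where p: "p \<noteq> []" "hd p = x" "last p = y" "distinct p"
    "successively (\<lambda>u v. (u, v) \<in> R) p" by blast
  show ?case
  proof (cases "z \<in> set p")
    case True
    then obtain p1 p2 where "p = p1 @ z # p2" by (meson split_list)
    then show ?thesis using p
      by (intro exI[of _ "p1 @ [z]"])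
         (cases p1, auto simp: successively_append_iff successively_Cons hd_append)
  next
    case False
    then show ?thesis using p step(2)
      by (intro exI[of _ "p @ [z]"]) (auto simp: successively_append_iff)
  qed
qed

text \<open>Abstracts \<open>ext_edges\<close> from \<open>S\<close>, so that an induction can
  insert one edge at a time.\<close>

definition bip_edges :: "('a \<times> 'b) set \<Rightarrow> ('a + 'b) set set" where
  "bip_edges B = {{Inl a, Inr b} | a b. (a, b) \<in> B}"

lemma bip_edges_iff: "{Inl a, Inr b} \<in> bip_edges B \<longleftrightarrow> (a, b) \<in> B"
  by (auto simp: bip_edges_def doubleton_eq_iff)

lemma bip_edges_mono: "B \<subseteq> B' \<Longrightarrow> bip_edges B \<subseteq> bip_edges B'"
  by (auto simp: bip_edges_def)

lemma ugraph_cycle_mono: "ugraph_cycle V E p \<Longrightarrow> V \<subseteq> V' \<Longrightarrow> E \<subseteq> E' \<Longrightarrow> ugraph_cycle V' E' p"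
  unfolding ugraph_cycle_def ugraph_walk_def by (auto elim!: successively_mono)

text \<open>Edges are inserted one at a time; as no cycle arises, the new edge joins two components, and
  the potential can be corrected by a constant on one of them.\<close>

lemma acyclic_potential:
  fixes g :: "'a \<Rightarrow> 'b \<Rightarrow> 'c \<Rightarrow> 'c"
  assumes "finite B" and "\<nexists>p. ugraph_cycle UNIV (bip_edges B) p" and g: "\<And>a b. bij (g a b)"
  shows "\<exists>\<phi> :: 'a + 'b \<Rightarrow> 'c \<Rightarrow> 'c. (\<forall>x. bij (\<phi> x)) \<and> (\<forall>a b z. (a, b) \<in> B \<longrightarrow> \<phi> (Inr b) (g a b z) = \<phi> (Inl a) z)"
  using assms(1,2)
proof (induction B)
  case empty
  show ?case by (intro exI[of _ "\<lambda>_ :: 'a + 'b. id :: 'c \<Rightarrow> 'c"]) simp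
next
  case (insert e B)
  obtain a b where e: "e = (a, b)" by (cases e)
  let ?R = "{(x, y). {x, y} \<in> bip_edges B}"
  have sub: "bip_edges B \<subseteq> bip_edges (insert e B)" by (rule bip_edges_mono) auto
  then have "\<nexists>p. ugraph_cycle UNIV (bip_edges B) p"
    using insert.prems ugraph_cycle_mono by blast
  then obtain \<phi> :: "'a + 'b \<Rightarrow> 'c \<Rightarrow> 'c" where \<phi>: "\<And>x. bij (\<phi> x)"
    "\<And>a b z. (a, b) \<in> B \<Longrightarrow> \<phi> (Inr b) (g a b z) = \<phi> (Inl a) z"
    using insert.IH by blast
  have nreach: "(Inr b, Inl a) \<notin> ?R\<^sup>*"
  proof
    assume "(Inr b, Inl a) \<in> ?R\<^sup>*"
    from rtrancl_simple_path[OF this] obtain p where p: "p \<noteq> []" "hd p = Inr b" "last p = Inl a"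
      "distinct p" "successively (\<lambda>u v. (u, v) \<in> ?R) p" by blast
    \<comment> \<open>With one vertex the path would lie on both sides of the bipartition; with two
      it would be the edge \<open>e\<close>, which is not in \<open>B\<close>.\<close>
    have "length p \<ge> 3"
    proof (rule ccontr)
      assume "\<not> length p \<ge> 3"
      then consider x where "p = [x]" | x y where "p = [x, y]"
        using p(1) by (cases p; cases "tl p"; cases "tl (tl p)") auto
      then show False
      proof cases
        case 2
        then have "{Inl a, Inr b} \<in> bip_edges B" using p by (simp add: insert_commute)
        then show ?thesis using insert.hyps(2) e by (simp add: bip_edges_iff)
      qed (use p in auto)
    qed
    moreover have "successively (\<lambda>u v. {u, v} \<in> bip_edges (insert e B)) p"
      using p(5) sub by (auto elim!: successively_mono)
    moreover have "{last p, hd p} \<in> bip_edges (insert e B)"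
      using p(2,3) e by (simp add: bip_edges_iff)
    ultimately have "ugraph_cycle UNIV (bip_edges (insert e B)) p"
      using p by (simp add: ugraph_cycle_def ugraph_walk_def)
    then show False using insert.prems by blast
  qed
  \<comment> \<open>\<open>C\<close> is the component of \<open>Inr b\<close> before
    \<open>e\<close> is added, and \<open>k\<close> is the only correction on it that satisfies the
    condition at \<open>e\<close>.\<close>
  define C where "C = {x. (Inr b, x) \<in> ?R\<^sup>*}"
  define k where "k = \<phi> (Inl a) \<circ> finv (g a b) \<circ> finv (\<phi> (Inr b))"
  have k: "bij k" unfolding k_def using \<phi>(1) g by (intro bij_comp bij_imp_bij_inv)
  have C: "Inl c \<in> C \<longleftrightarrow> Inr d \<in> C" if "(c, d) \<in> B" for c d
  proof -
    have "(Inl c, Inr d) \<in> ?R" "(Inr d, Inl c) \<in> ?R"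
      using that by (auto simp: bip_edges_iff insert_commute)
    then show ?thesis unfolding C_def by (blast intro: rtrancl_into_rtrancl)
  qed
  show ?case
  proof (intro exI conjI)
    let ?\<psi> = "\<lambda>x. if x \<in> C then k \<circ> \<phi> x else \<phi> x"
    show "\<forall>x. bij (?\<psi> x)" using k \<phi>(1) by (auto intro: bij_comp)
    show "\<forall>c d z. (c, d) \<in> insert e B \<longrightarrow> ?\<psi> (Inr d) (g c d z) = ?\<psi> (Inl c) z"
    proof (intro allI impI)
      fix c d z assume "(c, d) \<in> insert e B"
      then consider "(c, d) = (a, b)" | "(c, d) \<in> B" using e by blast
      then show "?\<psi> (Inr d) (g c d z) = ?\<psi> (Inl c) z"
      proof cases
        case 1
        moreover have "Inr b \<in> C" "Inl a \<notin> C" using nreach by (auto simp: C_def)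
        ultimately show ?thesis
          using bij_is_inj[OF \<phi>(1)] bij_is_inj[OF g] by (simp add: k_def)
      next
        case 2
        then show ?thesis using C \<phi>(2) by auto
      qed
    qed
  qed
qed

text \<open>The edges of the generalized extension graph of \<open>w\<close>, with words of length \<open>n\<close> on the left
  and of length \<open>m\<close> on the right.\<close>

definition gext :: "'a list set \<Rightarrow> nat \<Rightarrow> nat \<Rightarrow> 'a list \<Rightarrow> ('a list \<times> 'a list) set" where
  "gext S n m w = {(u, v). length u = n \<and> length v = m \<and> u @ w @ v \<in> S}"

section \<open>Specular sets and potentials on their generalized extension graphs\<close>

locale specular_set =
  fixes A :: "'a set" and \<theta> :: "'a \<Rightarrow> 'a" and S :: "'a list set"
  assumes finite_A: "finite A" and inv_\<theta>: "involution_on A \<theta>" and specular: "specular A \<theta> S"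
begin

lemma \<theta>_in [simp]: "a \<in> A \<Longrightarrow> \<theta> a \<in> A"
  and \<theta>_\<theta> [simp]: "a \<in> A \<Longrightarrow> \<theta> (\<theta> a) = a"
  using inv_\<theta> by (auto simp: involution_on_def)

lemma S_lists: "w \<in> S \<Longrightarrow> w \<in> lists A"
  and S_sublist: "w \<in> S \<Longrightarrow> sublist v w \<Longrightarrow> v \<in> S"
  and S_letter: "a \<in> A \<Longrightarrow> [a] \<in> S"
  and S_bi_ext: "w \<in> S \<Longrightarrow> bi_ext A S w \<noteq> {}"
  and S_reduced: "w \<in> S \<Longrightarrow> reduced A \<theta> w"
  and S_inv: "w \<in> S \<Longrightarrow> word_inv \<theta> w \<in> S"
  using specular
  unfolding specular_def laminary_def biextendable_def factorial_set_def symmetric_words_def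
  by blast+

lemma S_factor: "u @ v @ w \<in> S \<Longrightarrow> v \<in> S"
  using S_sublist sublist_appendI by blast

lemma S_prefix: "u @ v \<in> S \<Longrightarrow> u \<in> S" and S_suffix: "u @ v \<in> S \<Longrightarrow> v \<in> S"
  using S_factor[of "[]" u v] S_factor[of u v "[]"] by simp_all

lemma S_ext_left: "w \<in> S \<Longrightarrow> \<exists>u. length u = n \<and> u @ w \<in> S"
proof (induction n)
  case (Suc n)
  then obtain u where u: "length u = n" "u @ w \<in> S" by blast
  then obtain a b where "a # (u @ w) @ [b] \<in> S" using S_bi_ext[OF u(2)] by (auto simp: bi_ext_def)
  then have "(a # u) @ w \<in> S" using S_prefix[of "(a # u) @ w" "[b]"] by simp
  then show ?case using u by (intro exI[of _ "a # u"]) simp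
qed simp

lemma S_ext_right: "w \<in> S \<Longrightarrow> \<exists>v. length v = n \<and> w @ v \<in> S"
proof (induction n)
  case (Suc n)
  then obtain v where v: "length v = n" "w @ v \<in> S" by blast
  then obtain a b where "a # (w @ v) @ [b] \<in> S" using S_bi_ext[OF v(2)] by (auto simp: bi_ext_def)
  then have "w @ v @ [b] \<in> S" using S_suffix[of "[a]" "w @ v @ [b]"] by simp
  then show ?case using v by (intro exI[of _ "v @ [b]"]) simp
qed simp

definition trees :: "('a + 'a) set set" where
  "trees = (SOME P. partition_on (ext_vertices A S []) P \<and> finite P \<and> card P = 2 \<and>
     (\<forall>e\<in>ext_edges A S []. \<exists>C\<in>P. e \<subseteq> C) \<and>
     (\<forall>C\<in>P. ugraph_tree C {e\<in>ext_edges A S []. e \<subseteq> C}))"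

lemma trees: "partition_on (ext_vertices A S []) trees" "finite trees" "card trees = 2"
  "\<And>e. e \<in> ext_edges A S [] \<Longrightarrow> \<exists>C\<in>trees. e \<subseteq> C"
  "\<And>C. C \<in> trees \<Longrightarrow> ugraph_tree C {e\<in>ext_edges A S []. e \<subseteq> C}"
proof -
  have "\<exists>P. partition_on (ext_vertices A S []) P \<and> finite P \<and> card P = 2 \<and>
     (\<forall>e\<in>ext_edges A S []. \<exists>C\<in>P. e \<subseteq> C) \<and>
     (\<forall>C\<in>P. ugraph_tree C {e\<in>ext_edges A S []. e \<subseteq> C})"
    using specular unfolding specular_def tree_set_def disjoint_union_of_trees_def by blast
  from someI_ex[OF this, folded trees_def]
  show "partition_on (ext_vertices A S []) trees" "finite trees" "card trees = 2"
  "\<And>e. e \<in> ext_edges A S [] \<Longrightarrow> \<exists>C\<in>trees. e \<subseteq> C"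
  "\<And>C. C \<in> trees \<Longrightarrow> ugraph_tree C {e\<in>ext_edges A S []. e \<subseteq> C}" by blast+
qed

lemma trees_disjoint: "C \<in> trees \<Longrightarrow> D \<in> trees \<Longrightarrow> x \<in> C \<Longrightarrow> x \<in> D \<Longrightarrow> C = D"
  using trees(1) by (auto simp: partition_on_def disjoint_def)

lemma Nil_in_S: "[] \<in> S"
proof -
  obtain C where "C \<in> trees" using trees(2,3) by fastforce
  then have "ext_vertices A S [] \<noteq> {}"
    using trees(1) by (auto simp: partition_on_def)
  then obtain a where "[a] \<in> S" by (auto simp: ext_vertices_def left_ext_def right_ext_def)
  then show ?thesis using S_prefix[of "[]" "[a]"] by simp
qed

lemma ext_edges_eq: "ext_edges A S w = bip_edges (bi_ext A S w)"
  by (simp add: ext_edges_def bip_edges_def)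

lemma bi_ext_iff: "(a, b) \<in> bi_ext A S w \<longleftrightarrow> a # w @ [b] \<in> S"
  using S_lists[of "a # w @ [b]"] by (auto simp: bi_ext_def)

lemma ext_edges_vertices: "{x, y} \<in> ext_edges A S w \<Longrightarrow> x \<in> ext_vertices A S w"
proof -
  have "Inl a \<in> ext_vertices A S w \<and> Inr b \<in> ext_vertices A S w" if "(a, b) \<in> bi_ext A S w" for a b
    using that S_prefix[of "a # w" "[b]"] S_suffix[of "[a]" "w @ [b]"]
    by (auto simp: bi_ext_def ext_vertices_def left_ext_def right_ext_def)
  then show "{x, y} \<in> ext_edges A S w \<Longrightarrow> x \<in> ext_vertices A S w"
    by (fastforce simp: ext_edges_def doubleton_eq_iff)
qed

text \<open>The tree condition excludes cycles inside \<open>ext_vertices\<close>, or inside one of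
  the two trees if \<open>w = []\<close>. Each vertex of a cycle lies on an edge, hence in
  \<open>ext_vertices\<close>, and edges do not leave the tree that contains
  \<open>hd p\<close>.\<close>

lemma ext_acyclic:
  assumes w: "w \<in> S"
  shows "\<nexists>p. ugraph_cycle UNIV (ext_edges A S w) p"
proof
  assume "\<exists>p. ugraph_cycle UNIV (ext_edges A S w) p"
  then obtain p where p: "ugraph_cycle UNIV (ext_edges A S w) p" by blast
  then have ne: "p \<noteq> []" "length p \<ge> 3" "{last p, hd p} \<in> ext_edges A S w"
    "successively (\<lambda>x y. {x, y} \<in> ext_edges A S w) p"
    by (auto simp: ugraph_cycle_def ugraph_walk_def)
  have edge: "\<exists>y. {p ! i, y} \<in> ext_edges A S w" if "i < length p" for i
  proof (cases "Suc i < length p")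
    case True
    then show ?thesis using ne(4) by (auto simp: successively_conv_nth)
  next
    case False
    then have "i = length p - 1" using that by linarith
    then have "p ! i = last p" using ne(1) by (simp add: last_conv_nth)
    then show ?thesis using ne(3) by auto
  qed
  have V: "set p \<subseteq> ext_vertices A S w"
    using edge ext_edges_vertices by (auto simp: set_conv_nth)
  show False
  proof (cases "w = []")
    case False
    then have "ugraph_tree (ext_vertices A S w) (ext_edges A S w)"
      using specular w unfolding specular_def tree_set_def by blast
    then show False using p V unfolding ugraph_tree_def ugraph_cycle_def ugraph_walk_def by blast
  next
    case True
    have ext: "\<exists>C\<in>trees. e \<subseteq> C" if "e \<in> ext_edges A S w" for e using trees(4) True that by simp
    obtain C where C: "C \<in> trees" "hd p \<in> C" using ext[OF ne(3)] by auto
    have *: "y \<in> C" if "{x, y} \<in> ext_edges A S w" "x \<in> C" for x y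
      using ext[OF that(1)] that(2) C(1) trees_disjoint by blast
    have i: "p ! i \<in> C" if "i < length p" for i
      using that
    proof (induction i)
      case 0
      then show ?case using C(2) ne(1) by (simp add: hd_conv_nth)
    next
      case (Suc i)
      then show ?case using * [of "p ! i" "p ! Suc i"] ne(4) by (auto simp: successively_conv_nth)
    qed
    then have sC: "set p \<subseteq> C" by (auto simp: set_conv_nth)
    have "successively (\<lambda>x y. {x, y} \<in> {e\<in>ext_edges A S []. e \<subseteq> C}) p"
      using ne(4) i True by (simp add: successively_conv_nth)
    moreover have "{last p, hd p} \<in> {e\<in>ext_edges A S []. e \<subseteq> C}"
      using ne(1,3) sC True by auto
    ultimately have "ugraph_cycle C {e\<in>ext_edges A S []. e \<subseteq> C} p"
      using p sC unfolding ugraph_cycle_def ugraph_walk_def by blast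
    then show False using trees(5)[OF C(1)] unfolding ugraph_tree_def by blast
  qed
qed

lemma gext_potential_1_1:
  fixes g :: "'a list \<Rightarrow> 'a list \<Rightarrow> 'c \<Rightarrow> 'c"
  assumes "w \<in> S" and g: "\<And>u v. bij (g u v)"
  shows "\<exists>\<alpha> \<beta> :: 'a list \<Rightarrow> 'c \<Rightarrow> 'c. (\<forall>u. bij (\<alpha> u)) \<and> (\<forall>v. bij (\<beta> v)) \<and>
    (\<forall>u v z. (u, v) \<in> gext S 1 1 w \<longrightarrow> \<beta> v (g u v z) = \<alpha> u z)"
proof -
  have "finite (bi_ext A S w)"
    by (rule finite_subset[of _ "A \<times> A"]) (auto simp: bi_ext_def finite_A)
  from acyclic_potential[OF this ext_acyclic[OF assms(1), unfolded ext_edges_eq],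
    of "\<lambda>a b. g [a] [b]", OF g]
  obtain \<phi> :: "'a + 'a \<Rightarrow> 'c \<Rightarrow> 'c" where \<phi>: "\<And>x. bij (\<phi> x)"
    "\<And>a b z. (a, b) \<in> bi_ext A S w \<Longrightarrow> \<phi> (Inr b) (g [a] [b] z) = \<phi> (Inl a) z"
    by blast
  show ?thesis
  proof (intro exI conjI)
    show "\<forall>u. bij (\<phi> (Inl (hd u)))" "\<forall>v. bij (\<phi> (Inr (hd v)))" using \<phi>(1) by blast+
    show "\<forall>u v z. (u, v) \<in> gext S 1 1 w \<longrightarrow> \<phi> (Inr (hd v)) (g u v z) = \<phi> (Inl (hd u)) z"
      using \<phi>(2) by (auto simp: gext_def length_Suc_conv bi_ext_iff)
  qed
qed

text \<open>A potential on the graph of \<open>w @ v\<close> turns \<open>g u (v @ b)\<close> into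
  \<open>\<alpha> v u\<close>, which no longer involves \<open>b\<close>. This is the labelling to
  which the induction hypothesis is applied; the two right potentials are composed.\<close>

lemma gext_potential_1:
  fixes g :: "'a list \<Rightarrow> 'a list \<Rightarrow> 'c \<Rightarrow> 'c"
  assumes "w \<in> S" and g: "\<And>u v. bij (g u v)"
  shows "\<exists>\<alpha> \<beta> :: 'a list \<Rightarrow> 'c \<Rightarrow> 'c. (\<forall>u. bij (\<alpha> u)) \<and> (\<forall>v. bij (\<beta> v)) \<and>
    (\<forall>u v z. (u, v) \<in> gext S 1 m w \<longrightarrow> \<beta> v (g u v z) = \<alpha> u z)"
  using g
proof (induction m arbitrary: g)
  case 0
  have "bij (g u v)" for u v by (rule 0)
  then show ?case
    by - (rule exI[of _ "\<lambda>u. g u []"],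
      rule exI[of _ "\<lambda>_ :: 'a list. id :: 'c \<Rightarrow> 'c"], auto simp: gext_def)
next
  case (Suc m)
  have "\<forall>v. \<exists>\<alpha> \<beta> :: 'a list \<Rightarrow> 'c \<Rightarrow> 'c. (\<forall>u. bij (\<alpha> u)) \<and> (\<forall>v. bij (\<beta> v)) \<and>
    (\<forall>u b z. (u, b) \<in> gext S 1 1 (w @ v) \<longrightarrow> \<beta> b (g u (v @ b) z) = \<alpha> u z)"
  proof
    fix v show "\<exists>\<alpha> \<beta> :: 'a list \<Rightarrow> 'c \<Rightarrow> 'c. (\<forall>u. bij (\<alpha> u)) \<and> (\<forall>v. bij (\<beta> v)) \<and>
      (\<forall>u b z. (u, b) \<in> gext S 1 1 (w @ v) \<longrightarrow> \<beta> b (g u (v @ b) z) = \<alpha> u z)"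
    proof (cases "w @ v \<in> S")
      case True
      then show ?thesis using gext_potential_1_1[of _ "\<lambda>u b. g u (v @ b)"] Suc.prems by blast
    next
      case False
      then have "gext S 1 1 (w @ v) = {}" using S_factor[of _ "w @ v"] by (auto simp: gext_def)
      then show ?thesis by (intro exI[of _ "\<lambda>_ :: 'a list. id :: 'c \<Rightarrow> 'c"]) simp
    qed
  qed
  then obtain \<alpha> \<beta> :: "'a list \<Rightarrow> 'a list \<Rightarrow> 'c \<Rightarrow> 'c" where
    ab: "\<And>v u. bij (\<alpha> v u)" "\<And>v b. bij (\<beta> v b)"
    "\<And>v u b z. (u, b) \<in> gext S 1 1 (w @ v) \<Longrightarrow> \<beta> v b (g u (v @ b) z) = \<alpha> v u z"
    unfolding choice_iff by blast
  from Suc.IH[of "\<lambda>u v. \<alpha> v u"] ab(1)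
  obtain \<alpha>' \<beta>' :: "'a list \<Rightarrow> 'c \<Rightarrow> 'c" where
    ab': "\<And>u. bij (\<alpha>' u)" "\<And>b. bij (\<beta>' b)"
    "\<And>u v z. (u, v) \<in> gext S 1 m w \<Longrightarrow> \<beta>' v (\<alpha> v u z) = \<alpha>' u z" by blast
  show ?case
  proof (intro exI conjI)
    let ?\<beta> = "\<lambda>v. \<beta>' (butlast v) \<circ> \<beta> (butlast v) [last v]"
    show "\<forall>u. bij (\<alpha>' u)" using ab' by blast
    show "\<forall>v. bij (?\<beta> v)" using ab(2) ab'(2) by (intro allI bij_comp)
    show "\<forall>u v z. (u, v) \<in> gext S 1 (Suc m) w \<longrightarrow> ?\<beta> v (g u v z) = \<alpha>' u z"
    proof (intro allI impI)
      fix u v z assume uv: "(u, v) \<in> gext S 1 (Suc m) w"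
      then obtain v' b where v: "v = v' @ [b]" "length v' = m"
        by (auto simp: gext_def length_Suc_conv_rev)
      then have "(u, [b]) \<in> gext S 1 1 (w @ v')" "(u, v') \<in> gext S 1 m w"
        using uv S_prefix[of "u @ w @ v'" "[b]"] by (auto simp: gext_def)
      then show "?\<beta> v (g u v z) = \<alpha>' u z" using ab(3) ab'(3) v by simp
    qed
  qed
qed

text \<open>The same induction on the left. Since \<open>g (c @ u) v\<close> is
  \<open>\<alpha> u c\<close> followed by the inverse of \<open>\<beta> u v\<close>, this inverse is
  the labelling left for the induction hypothesis.\<close>

lemma gext_potential:
  fixes g :: "'a list \<Rightarrow> 'a list \<Rightarrow> 'c \<Rightarrow> 'c"
  assumes "w \<in> S" and g: "\<And>u v. bij (g u v)"
  shows "\<exists>\<alpha> \<beta> :: 'a list \<Rightarrow> 'c \<Rightarrow> 'c. (\<forall>u. bij (\<alpha> u)) \<and> (\<forall>v. bij (\<beta> v)) \<and>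
    (\<forall>u v z. (u, v) \<in> gext S n m w \<longrightarrow> \<beta> v (g u v z) = \<alpha> u z)"
  using g
proof (induction n arbitrary: g)
  case 0
  then show ?case
    by - (rule exI[of _ "\<lambda>_ :: 'a list. id :: 'c \<Rightarrow> 'c"],
      rule exI[of _ "\<lambda>v. finv (g [] v)"],
      auto simp: gext_def bij_is_inj bij_imp_bij_inv)
next
  case (Suc n)
  have "\<forall>u. \<exists>\<alpha> \<beta> :: 'a list \<Rightarrow> 'c \<Rightarrow> 'c. (\<forall>c. bij (\<alpha> c)) \<and> (\<forall>v. bij (\<beta> v)) \<and>
    (\<forall>c v z. (c, v) \<in> gext S 1 m (u @ w) \<longrightarrow> \<beta> v (g (c @ u) v z) = \<alpha> c z)"
  proof
    fix u show "\<exists>\<alpha> \<beta> :: 'a list \<Rightarrow> 'c \<Rightarrow> 'c. (\<forall>c. bij (\<alpha> c)) \<and> (\<forall>v. bij (\<beta> v)) \<and>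
      (\<forall>c v z. (c, v) \<in> gext S 1 m (u @ w) \<longrightarrow> \<beta> v (g (c @ u) v z) = \<alpha> c z)"
    proof (cases "u @ w \<in> S")
      case True
      then show ?thesis using gext_potential_1[of _ "\<lambda>c v. g (c @ u) v"] Suc.prems by blast
    next
      case False
      then have "gext S 1 m (u @ w) = {}" using S_factor[of _ "u @ w"] by (auto simp: gext_def)
      then show ?thesis by (intro exI[of _ "\<lambda>_ :: 'a list. id :: 'c \<Rightarrow> 'c"]) simp
    qed
  qed
  then obtain \<alpha> \<beta> :: "'a list \<Rightarrow> 'a list \<Rightarrow> 'c \<Rightarrow> 'c" where
    ab: "\<And>u c. bij (\<alpha> u c)" "\<And>u v. bij (\<beta> u v)"
    "\<And>u c v z. (c, v) \<in> gext S 1 m (u @ w) \<Longrightarrow> \<beta> u v (g (c @ u) v z) = \<alpha> u c z"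
    unfolding choice_iff by blast
  from Suc.IH[of "\<lambda>u v. finv (\<beta> u v)", OF bij_imp_bij_inv[OF ab(2)]]
  obtain \<alpha>' \<beta>' :: "'a list \<Rightarrow> 'c \<Rightarrow> 'c" where
    ab': "\<And>u. bij (\<alpha>' u)" "\<And>b. bij (\<beta>' b)"
    "\<And>u v z. (u, v) \<in> gext S n m w \<Longrightarrow> \<beta>' v (finv (\<beta> u v) z) = \<alpha>' u z"
    by blast
  show ?case
  proof (intro exI conjI)
    let ?\<alpha> = "\<lambda>u. \<alpha>' (tl u) \<circ> \<alpha> (tl u) [hd u]"
    show "\<forall>u. bij (?\<alpha> u)" using ab(1) ab'(1) by (intro allI bij_comp)
    show "\<forall>v. bij (\<beta>' v)" using ab' by blast
    show "\<forall>u v z. (u, v) \<in> gext S (Suc n) m w \<longrightarrow> \<beta>' v (g u v z) = ?\<alpha> u z"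
    proof (intro allI impI)
      fix u v z assume uv: "(u, v) \<in> gext S (Suc n) m w"
      then obtain u' c where u: "u = c # u'" "length u' = n"
        by (auto simp: gext_def length_Suc_conv)
      then have *: "([c], v) \<in> gext S 1 m (u' @ w)" "(u', v) \<in> gext S n m w"
        using uv S_suffix[of "[c]" "u' @ w @ v"] by (auto simp: gext_def)
      have "g u v z = finv (\<beta> u' v) (\<alpha> u' [c] z)"
        using ab(3)[OF *(1), of z] bij_is_inj[OF ab(2)] u by (metis append_Cons append_Nil inv_f_f)
      then show "\<beta>' v (g u v z) = ?\<alpha> u z" using ab'(3)[OF *(2)] u by simp
    qed
  qed
qed

text \<open>The predicates \<open>tyL\<close> and \<open>tyR\<close> tell to which of the two trees of the extension graph of the
  empty word the left and the right copy of a letter belong.\<close>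

definition T0 :: "('a + 'a) set" where "T0 = (SOME C. C \<in> trees)"

definition tyL :: "'a \<Rightarrow> bool" where "tyL a \<longleftrightarrow> Inl a \<in> T0"
definition tyR :: "'a \<Rightarrow> bool" where "tyR a \<longleftrightarrow> Inr a \<in> T0"

lemma T0: "T0 \<in> trees"
proof -
  have "trees \<noteq> {}" using trees(3) by fastforce
  then show ?thesis unfolding T0_def by (metis ex_in_conv someI_ex)
qed

lemma tyL_eq_tyR: "[a, b] \<in> S \<Longrightarrow> tyL a = tyR b"
proof -
  assume "[a, b] \<in> S"
  then have "{Inl a, Inr b} \<in> ext_edges A S []"
    by (simp add: ext_edges_eq bip_edges_iff bi_ext_iff)
  from trees(4)[OF this] obtain C where "C \<in> trees" "Inl a \<in> C" "Inr b \<in> C" by auto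
  then show ?thesis unfolding tyL_def tyR_def using T0 trees_disjoint by metis
qed

section \<open>Connectedness: functions that agree across all edges\<close>

lemma walk_const:
  assumes "\<And>x y. {x, y} \<in> E \<Longrightarrow> F x = F y" "ugraph_walk V E p"
  shows "F (hd p) = F (last p)"
proof -
  have "p \<noteq> []" "successively (\<lambda>x y. {x, y} \<in> E) p" using assms(2) by (auto simp: ugraph_walk_def)
  then show ?thesis
  proof (induction p rule: induct_list012)
    case (3 x y zs)
    then show ?case using assms(1)[of x y] by auto
  qed auto
qed

lemma tree_const:
  assumes "\<And>x y. {x, y} \<in> E \<Longrightarrow> F x = F y" "ugraph_tree V E"
  shows "\<exists>k. \<forall>x\<in>V. F x = k"
proof -
  obtain x where "x \<in> V" using assms(2) by (auto simp: ugraph_tree_def)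
  have "F y = F x" if "y \<in> V" for y
  proof -
    obtain p where "ugraph_walk V E p" "hd p = y" "last p = x"
      using assms(2) \<open>x \<in> V\<close> \<open>y \<in> V\<close> unfolding ugraph_tree_def ugraph_connected_def by blast
    then show ?thesis using walk_const[of E F, OF assms(1)] by blast
  qed
  then show ?thesis by blast
qed

text \<open>Together \<open>f\<close> and \<open>h\<close> form a function constant on each tree. A
  nonempty \<open>w\<close> has a single tree; for the empty word \<open>tyR b\<close> tells which
  tree contains the edge. The argument of \<open>k\<close> covers both cases.\<close>

lemma gext_const_1_1:
  assumes w: "w \<in> S" and fh: "\<And>a b. a # w @ [b] \<in> S \<Longrightarrow> f a = h b"
  shows "\<exists>k. \<forall>a b. a # w @ [b] \<in> S \<longrightarrow> f a = k (w = [] \<and> tyR b)"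
proof -
  define F where "F = case_sum f h"
  have F: "F x = F y" if "{x, y} \<in> ext_edges A S w" for x y
    using that fh unfolding ext_edges_eq
    by (auto simp: bip_edges_def F_def bi_ext_iff doubleton_eq_iff)
  show ?thesis
  proof (cases "w = []")
    case False
    then have "ugraph_tree (ext_vertices A S w) (ext_edges A S w)"
      using specular w unfolding specular_def tree_set_def by blast
    from tree_const[of _ F, OF F this] obtain k where k: "\<forall>x\<in>ext_vertices A S w. F x = k" by blast
    have "f a = k" if "a # w @ [b] \<in> S" for a b
    proof -
      have "Inl a \<in> ext_vertices A S w"
        using that S_lists[OF that] S_prefix[of "a # w" "[b]"]
        by (auto simp: ext_vertices_def left_ext_def)
      then show ?thesis using k by (auto simp: F_def)
    qed
    then show ?thesis using False by (intro exI[of _ "\<lambda>_. k"]) auto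
  next
    case True
    have "\<forall>C\<in>trees. \<exists>k. \<forall>x\<in>C. F x = k"
    proof
      fix C assume "C \<in> trees"
      show "\<exists>k. \<forall>x\<in>C. F x = k"
        by (rule tree_const[of _ F, OF _ trees(5)[OF \<open>C \<in> trees\<close>]]) (use F True in auto)
    qed
    then obtain \<kappa> where \<kappa>: "\<And>C x. C \<in> trees \<Longrightarrow> x \<in> C \<Longrightarrow> F x = \<kappa> C" by metis
    obtain T1 where T1: "trees = {T0, T1}"
      using T0 trees(2,3) by (metis card_2_iff insertE singletonD insert_commute)
    have "f a = (if tyR b then \<kappa> T0 else \<kappa> T1)" if ab: "[a, b] \<in> S" for a b
    proof -
      have "{Inl a, Inr b} \<in> ext_edges A S []"
        using ab by (simp add: ext_edges_eq bip_edges_iff bi_ext_iff)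
      from trees(4)[OF this] obtain C where C: "C \<in> trees" "Inl a \<in> C" "Inr b \<in> C" by auto
      have "f a = \<kappa> C" using \<kappa>[OF C(1,2)] by (simp add: F_def)
      moreover have "C = (if tyR b then T0 else T1)"
        using C(1,3) T1 trees_disjoint[OF C(1) T0 C(3)] unfolding tyR_def by auto
      ultimately show ?thesis by simp
    qed
    then show ?thesis
      using True by (intro exI[of _ "\<lambda>c. if c then \<kappa> T0 else \<kappa> T1"]) simp
  qed
qed

text \<open>For nonempty \<open>v\<close>, the graph of \<open>w @ v\<close> is a single tree, so
  \<open>f\<close> depends on \<open>v\<close> alone where a letter is added behind
  \<open>v\<close>. This yields a function \<open>h'\<close> of shorter words for the induction
  hypothesis. Right words are kept nonempty for the sake of \<open>hd v\<close>.\<close>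

lemma gext_const_1:
  assumes w: "w \<in> S" and "\<And>u v. (u, v) \<in> gext S 1 (Suc m) w \<Longrightarrow> f u = h v"
  shows "\<exists>k. \<forall>u v. (u, v) \<in> gext S 1 (Suc m) w \<longrightarrow> f u = k (w = [] \<and> tyR (hd v))"
  using assms(2)
proof (induction m arbitrary: h)
  case 0
  from gext_const_1_1[OF w, of "\<lambda>a. f [a]" "\<lambda>b. h [b]"] 0
  obtain k where "\<forall>a b. a # w @ [b] \<in> S \<longrightarrow> f [a] = k (w = [] \<and> tyR b)"
    by (auto simp: gext_def)
  then show ?case by (intro exI[of _ k]) (auto simp: gext_def length_Suc_conv)
next
  case (Suc m)
  have "\<exists>k. \<forall>c b. c # (w @ v) @ [b] \<in> S \<longrightarrow> f [c] = k" if "length v = Suc m" for v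
  proof (cases "w @ v \<in> S")
    case True
    have "f [c] = h (v @ [b])" if "c # (w @ v) @ [b] \<in> S" for c b
      using Suc.prems[of "[c]" "v @ [b]"] that \<open>length v = Suc m\<close> by (simp add: gext_def)
    from gext_const_1_1[OF True, of "\<lambda>c. f [c]" "\<lambda>b. h (v @ [b])", OF this]
    obtain k where "\<forall>c b. c # (w @ v) @ [b] \<in> S \<longrightarrow> f [c] = k (w @ v = [] \<and> tyR b)" by blast
    moreover have "v \<noteq> []" using that by auto
    ultimately show ?thesis by (intro exI[of _ "k False"]) simp
  next
    case False
    then show ?thesis using S_factor[of "[_]" "w @ v" "[_]"] by auto
  qed
  then obtain h' where h': "\<And>v c b. length v = Suc m \<Longrightarrow> c # (w @ v) @ [b] \<in> S \<Longrightarrow> f [c] = h' v"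
    by metis
  have "f u = h' v" if "(u, v) \<in> gext S 1 (Suc m) w" for u v
  proof -
    from that obtain c where u: "u = [c]" "length v = Suc m" "c # w @ v \<in> S"
      by (auto simp: gext_def length_Suc_conv)
    obtain b where "(c # w @ v) @ [b] \<in> S" using S_ext_right[OF u(3), of 1]
      by (auto simp: length_Suc_conv)
    then show ?thesis using h' u by simp
  qed
  from Suc.IH[of h', OF this] obtain k where
    k: "\<And>u v. (u, v) \<in> gext S 1 (Suc m) w \<Longrightarrow> f u = k (w = [] \<and> tyR (hd v))" by blast
  have "f u = k (w = [] \<and> tyR (hd v))" if uv: "(u, v) \<in> gext S 1 (Suc (Suc m)) w" for u v
  proof -
    obtain v' b where v: "v = v' @ [b]" "length v' = Suc m"
      using uv unfolding gext_def by (auto simp: length_Suc_conv_rev[of v])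
    then have "(u, v') \<in> gext S 1 (Suc m) w"
      using uv S_prefix[of "u @ w @ v'" "[b]"] by (auto simp: gext_def)
    moreover have "v' \<noteq> []" using v by auto
    ultimately show ?thesis using k v by simp
  qed
  then show ?case by blast
qed

text \<open>The mirrored induction: the graph of \<open>u @ w\<close> has only one component, so
  \<open>f (c @ u)\<close> does not depend on \<open>c\<close> and \<open>f'\<close> replaces
  \<open>f\<close>.\<close>

lemma gext_const_Suc:
  assumes w: "w \<in> S" and "\<And>u v. (u, v) \<in> gext S (Suc n) (Suc m) w \<Longrightarrow> f u = h v"
  shows "\<exists>k. \<forall>u v. (u, v) \<in> gext S (Suc n) (Suc m) w \<longrightarrow> f u = k (w = [] \<and> tyR (hd v))"
  using assms(2)
proof (induction n arbitrary: f)
  case 0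
  then show ?case using gext_const_1[OF w, of m f h] unfolding One_nat_def by blast
next
  case (Suc n)
  have "\<exists>k. \<forall>c v. (c, v) \<in> gext S 1 (Suc m) (u @ w) \<longrightarrow> f (c @ u) = k" if "length u = Suc n" for u
  proof (cases "u @ w \<in> S")
    case True
    have "f (c @ u) = h v" if "(c, v) \<in> gext S 1 (Suc m) (u @ w)" for c v
      using Suc.prems[of "c @ u" v] that \<open>length u = Suc n\<close> by (simp add: gext_def)
    from gext_const_1[OF True, of m "\<lambda>c. f (c @ u)" h, OF this]
    obtain k where "\<forall>c v. (c, v) \<in> gext S 1 (Suc m) (u @ w) \<longrightarrow>
      f (c @ u) = k (u @ w = [] \<and> tyR (hd v))" by blast
    moreover have "u \<noteq> []" using that by auto
    ultimately show ?thesis by (intro exI[of _ "k False"]) simp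
  next
    case False
    then show ?thesis using S_factor[of _ "u @ w"] by (auto simp: gext_def)
  qed
  then obtain f' where f': "\<And>u c v. length u = Suc n \<Longrightarrow> (c, v) \<in> gext S 1 (Suc m) (u @ w) \<Longrightarrow>
    f (c @ u) = f' u" by metis
  have cu: "f' u = h v" if "(u, v) \<in> gext S (Suc n) (Suc m) w" for u v
  proof -
    from that have u: "length u = Suc n" "length v = Suc m" "u @ w @ v \<in> S"
      by (auto simp: gext_def)
    obtain c where "length c = 1" "c @ u @ w @ v \<in> S" using S_ext_left[OF u(3), of 1] by blast
    then show ?thesis using f'[OF u(1), of c v] Suc.prems[of "c @ u" v] u by (simp add: gext_def)
  qed
  from Suc.IH[of f', OF this] obtain k where
    k: "\<And>u v. (u, v) \<in> gext S (Suc n) (Suc m) w \<Longrightarrow> f' u = k (w = [] \<and> tyR (hd v))" by blast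
  have "f u = k (w = [] \<and> tyR (hd v))" if uv: "(u, v) \<in> gext S (Suc (Suc n)) (Suc m) w" for u v
  proof -
    obtain c u' where u: "u = [c] @ u'" "length u' = Suc n"
      using uv unfolding gext_def by (auto simp: length_Suc_conv[of u])
    then have "(u', v) \<in> gext S (Suc n) (Suc m) w" "([c], v) \<in> gext S 1 (Suc m) (u' @ w)"
      using uv S_suffix[of "[c]" "u' @ w @ v"] by (auto simp: gext_def)
    then show ?thesis using k f'[OF u(2)] u by metis
  qed
  then show ?case by blast
qed

lemma gext_const:
  assumes "w \<in> S" "N \<ge> 1" and "\<And>u v. (u, v) \<in> gext S N N w \<Longrightarrow> f u = h v"
  shows "\<exists>k. \<forall>u v. (u, v) \<in> gext S N N w \<longrightarrow> f u = k (w = [] \<and> tyR (hd v))"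
proof -
  obtain n where "N = Suc n" using assms(2) by (cases N) auto
  then show ?thesis using gext_const_Suc[OF assms(1)] assms(3) by blast
qed

text \<open>Otherwise the mirror image of edges, \<open>(a, b) \<mapsto> (\<theta> b, \<theta> a)\<close>, would map a tree to itself while
  exchanging its two sides. Weighting one edge of each mirrored pair by \<open>1 \<in> \<int>/2\<close> (no edge is
  its own mirror image, since \<open>S\<close> consists of reduced words) and adding to a potential its mirror
  image yields a proper 2-colouring of the tree which is invariant under the mirror map.\<close>

lemma tyR_\<theta>:
  assumes "a \<in> A"
  shows "tyR (\<theta> a) \<longleftrightarrow> \<not> tyL a"
proof -
  \<comment> \<open>Comparing the numbers \<open>e (a, b)\<close> selects the edge of weight 1 in
    each mirrored pair.\<close>
  obtain e :: "'a \<times> 'a \<Rightarrow> nat" where e: "inj_on e (A \<times> A)"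
    using finite_imp_inj_to_nat_seg[of "A \<times> A"] finite_A by auto
  define c where "c a b \<longleftrightarrow> e (a, b) < e (\<theta> b, \<theta> a)" for a b
  have c: "c a b \<noteq> c (\<theta> b) (\<theta> a)" if ab: "[a, b] \<in> S" for a b
  proof -
    have in_A: "a \<in> A" "b \<in> A" using S_lists[OF ab] by auto
    have "b \<noteq> \<theta> a" using S_reduced[OF ab] in_A by (auto simp: reduced_def)
    then have "e (a, b) \<noteq> e (\<theta> b, \<theta> a)" using inj_onD[OF e, of "(a, b)" "(\<theta> b, \<theta> a)"] in_A by auto
    then show ?thesis using in_A by (auto simp: c_def)
  qed
  have "bij (\<lambda>z. z \<noteq> c a b)" for a b by (rule bijI') auto
  from gext_potential_1_1[OF Nil_in_S, of "\<lambda>u v z. z \<noteq> c (hd u) (hd v)"]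
  obtain \<alpha> \<beta> :: "'a list \<Rightarrow> bool \<Rightarrow> bool" where
    ab: "\<And>u. bij (\<alpha> u)" "\<And>v. bij (\<beta> v)"
    "\<And>u v z. (u, v) \<in> gext S 1 1 [] \<Longrightarrow> \<beta> v (z \<noteq> c (hd u) (hd v)) = \<alpha> u z"
    using \<open>\<And>a b. bij (\<lambda>z. z \<noteq> c a b)\<close> by blast
  have flip: "\<beta> v (\<not> z) = (\<not> \<beta> v z)" for v z
    using inj_eq[OF bij_is_inj[OF ab(2)[of v]], of "\<not> z" z] by auto
  \<comment> \<open>\<open>f\<close> is the sum modulo 2 of the potential and its mirror image. The
    sum changes along every edge, so \<open>h\<close> is its negation on the right; then
    \<open>f\<close> and \<open>h\<close> agree on edges, while \<open>f a\<close> and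
    \<open>h (\<theta> a)\<close> differ.\<close>
  define f where "f a \<longleftrightarrow> (\<alpha> [a] True \<noteq> \<beta> [\<theta> a] True)" for a
  define h where "h b \<longleftrightarrow> (\<beta> [b] True = \<alpha> [\<theta> b] True)" for b
  have "f a = h b" if "a # [] @ [b] \<in> S" for a b
  proof -
    have ab_S: "[a, b] \<in> S" using that by simp
    then have "[\<theta> b, \<theta> a] \<in> S" using S_inv[of "[a, b]"] by (simp add: word_inv_def)
    then show ?thesis
      using ab(3)[of "[a]" "[b]" True] ab(3)[of "[\<theta> b]" "[\<theta> a]" True] ab_S c[OF ab_S]
        flip[of "[b]" True] flip[of "[\<theta> a]" True]
      unfolding f_def h_def gext_def by auto
  qed
  from gext_const_1_1[of "[]" f h, OF Nil_in_S this]
  obtain k where k: "\<And>a b. [a, b] \<in> S \<Longrightarrow> f a = k (tyR b)" by auto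
  obtain b where ab: "[a, b] \<in> S"
    using S_ext_right[OF S_letter[OF assms], of 1] by (auto simp: length_Suc_conv)
  obtain b' where ab': "[b', \<theta> a] \<in> S"
    using S_ext_left[OF S_letter[of "\<theta> a"], of 1] assms by (auto simp: length_Suc_conv)
  have "f a = k (tyL a)" using k[OF ab] tyL_eq_tyR[OF ab] by simp
  moreover have "h (\<theta> a) = k (tyR (\<theta> a))"
    using k[OF ab'] ab' \<open>\<And>b a. a # [] @ [b] \<in> S \<Longrightarrow> f a = h b\<close> by simp
  moreover have "f a = (\<not> h (\<theta> a))" using assms by (auto simp: f_def h_def)
  ultimately show ?thesis by (cases "tyR (\<theta> a)"; cases "tyL a") auto
qed

end

section \<open>Cocycles and the action of the group\<close>

text \<open>A stack is a reduced word read backwards: its head is the last letter.\<close>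

definition red_stacks :: "'b set \<Rightarrow> ('b \<Rightarrow> 'b) \<Rightarrow> 'b list set" where
  "red_stacks X \<iota> = {g \<in> lists X. successively (\<lambda>y x. y \<noteq> \<iota> x) g}"

text \<open>Multiplication by \<open>x\<close> with cancellation. It is the identity off
  \<open>X\<close> and off the reduced stacks, which makes it a permutation of the whole
  type.\<close>

definition push :: "'b set \<Rightarrow> ('b \<Rightarrow> 'b) \<Rightarrow> 'b \<Rightarrow> 'b list \<Rightarrow> 'b list" where
  "push X \<iota> x g = (if x \<in> X \<and> g \<in> red_stacks X \<iota>
     then (if g \<noteq> [] \<and> hd g = \<iota> x then tl g else x # g) else g)"

lemma push_push:
  assumes "involution_on X \<iota>" "x \<in> X"
  shows "push X \<iota> (\<iota> x) (push X \<iota> x g) = g"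
proof (cases "g \<in> red_stacks X \<iota>")
  case True
  have i: "\<iota> x \<in> X" "\<iota> (\<iota> x) = x" using assms by (auto simp: involution_on_def)
  show ?thesis
  proof (cases g)
    case Nil
    then show ?thesis using assms(2) i by (simp add: push_def red_stacks_def)
  next
    case (Cons y g')
    have y: "y \<in> X" "\<iota> (\<iota> y) = y" using True Cons assms(1) by (auto simp: red_stacks_def involution_on_def)
    show ?thesis
    proof (cases "y = \<iota> x")
      case True
      \<comment> \<open>As \<open>g\<close> is reduced, \<open>x\<close> is not on top of
        \<open>g'\<close>, so pushing \<open>\<iota> x\<close> restores the letter instead of
        cancelling another one.\<close>
      have "g' \<in> red_stacks X \<iota>" "\<not> (g' \<noteq> [] \<and> hd g' = x)"
        using \<open>g \<in> red_stacks X \<iota>\<close> Cons True i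
        by (auto simp: red_stacks_def successively_Cons)
      then show ?thesis using True Cons assms(2) i \<open>g \<in> red_stacks X \<iota>\<close> by (auto simp: push_def)
    next
      case False
      then have "x # g \<in> red_stacks X \<iota>"
        using \<open>g \<in> red_stacks X \<iota>\<close> Cons assms(2) y i by (auto simp: red_stacks_def successively_Cons)
      then show ?thesis using False Cons assms(2) i \<open>g \<in> red_stacks X \<iota>\<close> by (auto simp: push_def)
    qed
  qed
qed (simp add: push_def)

lemma bij_push:
  assumes "involution_on X \<iota>"
  shows "bij (push X \<iota> x)"
proof (cases "x \<in> X")
  case True
  have i: "\<iota> x \<in> X" "\<iota> (\<iota> x) = x" using assms True by (auto simp: involution_on_def)
  show ?thesis
    by (rule o_bij[of "push X \<iota> (\<iota> x)"])
       (use push_push[OF assms True] push_push[OF assms i(1)] i(2) in \<open>auto simp: fun_eq_iff\<close>)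
next
  case False
  then have "push X \<iota> x = (\<lambda>g. g)" by (auto simp: push_def)
  then show ?thesis by simp
qed

text \<open>A reduced word causes no cancellation. In \<open>freeness\<close> this shows that only
  the empty product leads back to the empty stack.\<close>

lemma fold_push:
  assumes "involution_on X \<iota>" "xs \<in> lists X" "successively (\<lambda>x y. y \<noteq> \<iota> x) xs"
  shows "fold (push X \<iota>) xs [] = rev xs \<and> rev xs \<in> red_stacks X \<iota>"
  using assms(2,3)
proof (induction xs rule: rev_induct)
  case Nil
  then show ?case by (simp add: red_stacks_def)
next
  case (snoc x xs)
  then have IH: "fold (push X \<iota>) xs [] = rev xs" "rev xs \<in> red_stacks X \<iota>"
    by (auto simp: successively_append_iff)
  have x: "x \<in> X" using snoc.prems by simp
  have *: "hd (rev xs) \<noteq> \<iota> x \<and> x \<noteq> \<iota> (hd (rev xs))" if "xs \<noteq> []"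
  proof -
    have "x \<noteq> \<iota> (last xs)" using snoc.prems that by (simp add: successively_append_iff)
    moreover have "\<iota> (\<iota> x) = x" using x assms(1) by (auto simp: involution_on_def)
    ultimately show ?thesis using that by (auto simp: hd_rev)
  qed
  then have "push X \<iota> x (rev xs) = x # rev xs" using x IH(2) by (auto simp: push_def)
  moreover have "x # rev xs \<in> red_stacks X \<iota>"
    using x IH(2) * by (auto simp: red_stacks_def successively_Cons)
  ultimately show ?case using IH by simp
qed

text \<open>Inside the finite set \<open>D \<union> f\<close>
  D\<open>the complements of\<close>D\<open>and\<close>f \<open>D\<close> have equal size and are
  matched; elsewhere the identity is used. This turns partial transitions of an automaton into
  permutations.\<close>

lemma inj_on_extend_bij:
  fixes f :: "'b \<Rightarrow> 'b"
  assumes "finite D" "inj_on f D"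
  shows "\<exists>h. bij h \<and> (\<forall>x\<in>D. h x = f x)"
proof -
  let ?C = "D \<union> f ` D"
  have fin: "finite ?C" using assms by simp
  have "card (?C - D) = card (?C - f ` D)"
    using fin assms card_image[OF assms(2)] by (simp add: card_Diff_subset)
  then obtain b where b: "bij_betw b (?C - D) (?C - f ` D)"
    using finite_same_card_bij[of "?C - D" "?C - f ` D"] fin by auto
  have "bij_betw f D (f ` D)" using assms(2) by (simp add: bij_betw_def)
  from bij_betw_disjoint_Un[OF this b]
  have C: "bij_betw (\<lambda>x. if x \<in> D then f x else b x) ?C ?C"
    by (auto simp: Un_Diff_cancel Un_absorb1 Un_absorb2 sup_commute)
  have "bij_betw (\<lambda>x. x) (- ?C) (- ?C)" by (simp add: bij_betw_def)
  from bij_betw_disjoint_Un[OF C this]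
  have "bij_betw (\<lambda>x. if x \<in> ?C then if x \<in> D then f x else b x else x) (?C \<union> - ?C) (?C \<union> - ?C)"
    by blast
  then have "bij (\<lambda>x. if x \<in> ?C then if x \<in> D then f x else b x else x)"
    unfolding Compl_partition .
  then show ?thesis by (intro exI[of _ "\<lambda>x. if x \<in> ?C then if x \<in> D then f x else b x else x"]) auto
qed

text \<open>\<open>u\<close> is a sliding window holding the most recent letters; its length does
  not change.\<close>

fun run :: "('a list \<Rightarrow> 'a \<Rightarrow> 'c \<Rightarrow> 'c) \<Rightarrow> 'a list \<Rightarrow> 'a list \<Rightarrow> 'c \<Rightarrow> 'c" where
  "run t u [] z = z"
| "run t u (a # v) z = run t (tl (u @ [a])) v (t u a z)"

lemma drop_Suc_snoc: "u \<noteq> [] \<Longrightarrow> drop (Suc n) (u @ a # v) = drop n (tl (u @ [a]) @ v)"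
  by (cases u) auto

lemma run_append:
  "u \<noteq> [] \<Longrightarrow> run t u (v @ v') z = run t (drop (length v) (u @ v)) v' (run t u v z)"
proof (induction v arbitrary: u z)
  case (Cons a v)
  have "tl (u @ [a]) \<noteq> []" using Cons.prems by (cases u) auto
  from Cons.IH[OF this] show ?case
    by (simp only: append_Cons run.simps length_Cons drop_Suc_snoc[OF Cons.prems])
qed simp

section \<open>From transitions depending on a window to transitions depending on a letter\<close>

context specular_set
begin

text \<open>The transition read along \<open>v\<close> from a window \<open>u\<close> is a labelling of the edges of
  \<open>gext S N N []\<close>. Reading one letter \<open>a\<close> shifts both windows, and by the connectedness of
  \<open>gext S N N [a]\<close> the effect on the potential depends only on \<open>a\<close>.\<close>

lemma cocycle:
  fixes t :: "'a list \<Rightarrow> 'a \<Rightarrow> 'c \<Rightarrow> 'c"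
  assumes t: "\<And>u a. bij (t u a)" and N: "N \<ge> 1"
  shows "\<exists>(\<alpha> :: 'a list \<Rightarrow> 'c \<Rightarrow> 'c) (\<beta> :: 'a list \<Rightarrow> 'c \<Rightarrow> 'c) (\<sigma> :: 'a \<Rightarrow> 'c \<Rightarrow> 'c).
    (\<forall>u. bij (\<alpha> u)) \<and> (\<forall>a. bij (\<sigma> a)) \<and>
    (\<forall>u v z. (u, v) \<in> gext S N N [] \<longrightarrow> \<beta> v (run t u v z) = \<alpha> u z) \<and>
    (\<forall>u a z. length u = N \<longrightarrow> u @ [a] \<in> S \<longrightarrow> \<alpha> (tl (u @ [a])) (t u a z) = \<sigma> a (\<alpha> u z))"
proof -
  have "bij (run t u v)" for u v
  proof (induction v arbitrary: u)
    case Nil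
    have "run t u [] = (\<lambda>z. z)" by auto
    then show ?case by simp
  next
    case (Cons a v)
    have "run t u (a # v) = run t (tl (u @ [a])) v \<circ> t u a" by auto
    then show ?case using bij_comp[OF t Cons.IH] by (simp only:)
  qed
  from gext_potential[OF Nil_in_S, of "run t", OF this, of N N]
  obtain \<alpha> \<beta> :: "'a list \<Rightarrow> 'c \<Rightarrow> 'c" where
    ab: "\<And>u. bij (\<alpha> u)" "\<And>v. bij (\<beta> v)"
    "\<And>u v z. (u, v) \<in> gext S N N [] \<Longrightarrow> \<beta> v (run t u v z) = \<alpha> u z" by blast
  have "\<exists>s. bij s \<and> (\<forall>u z. length u = N \<longrightarrow> u @ [a] \<in> S \<longrightarrow>
    \<alpha> (tl (u @ [a])) (t u a z) = s (\<alpha> u z))" for a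
  proof (cases "a \<in> A")
    case False
    have "u @ [a] \<notin> S" for u using False S_lists[of "u @ [a]"] by auto
    then show ?thesis using bij_ident by blast
  next
    case True
    \<comment> \<open>\<open>f u\<close> is the effect of reading \<open>a\<close>, seen through
      \<open>\<alpha>\<close>. Through \<open>\<beta>\<close> the same map is seen \<open>N\<close>
      letters later, when the window is \<open>a # butlast v\<close> and the letter read is
      \<open>last v\<close>; this is \<open>h v\<close>.\<close>
    define f where "f u = \<alpha> (tl (u @ [a])) \<circ> t u a \<circ> finv (\<alpha> u)" for u
    define h where "h v = \<beta> v \<circ> t (a # butlast v) (last v) \<circ> finv (\<beta> (a # butlast v))" for v
    have "f u = h v" if uv: "(u, v) \<in> gext S N N [a]" for u v
    proof
      fix y
      define z where "z = finv (\<alpha> u) y"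
      have z: "\<alpha> u z = y" unfolding z_def using ab(1) by (simp add: bij_is_surj surj_f_inv_f)
      have uv': "length u = N" "length v = N" "u @ [a] @ v \<in> S" using uv by (auto simp: gext_def)
      then have "u \<noteq> []" using N by auto
      obtain v' b where v: "v = v' @ [b]" using uv' N by (cases v rule: rev_cases) auto
      have *: "tl (u @ [a]) @ v = tl (u @ [a] @ v)" using \<open>u \<noteq> []\<close> by (cases u) auto
      have "(tl (u @ [a]), v) \<in> gext S N N []"
        using uv' S_suffix[of "[hd u]" "tl u @ [a] @ v"] \<open>u \<noteq> []\<close> by (cases u) (auto simp: gext_def)
      from ab(3)[OF this, of "t u a z"]
      have "\<alpha> (tl (u @ [a])) (t u a z) = \<beta> v (run t u ((a # v') @ [b]) z)" using v by simp
      also have "\<dots> = \<beta> v (t (a # v') b (run t u (a # v') z))"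
        using run_append[OF \<open>u \<noteq> []\<close>, of t "a # v'" "[b]" z] uv' v by simp
      also have "run t u (a # v') z = finv (\<beta> (a # v')) (\<alpha> u z)"
      proof -
        have "(u, a # v') \<in> gext S N N []"
          using uv' v S_prefix[of "u @ a # v'" "[b]"] by (auto simp: gext_def)
        from ab(3)[OF this] show ?thesis using bij_is_inj[OF ab(2)] by (metis inv_f_f)
      qed
      finally show "f u y = h v y" using v z by (simp add: f_def h_def z_def)
    qed
    \<comment> \<open>Since \<open>[a]\<close> is nonempty, \<open>k False\<close> is the only
      value; it becomes \<open>\<sigma> a\<close>.\<close>
    from gext_const[OF S_letter[OF True] N, of f h, OF this] obtain k where
      k: "\<And>u v. (u, v) \<in> gext S N N [a] \<Longrightarrow> f u = k False" by auto
    have fk: "f u = k False" if u: "length u = N" "u @ [a] \<in> S" for u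
    proof -
      obtain v where "length v = N" "(u @ [a]) @ v \<in> S" using S_ext_right[OF u(2)] by blast
      then show ?thesis using k[of u v] u by (simp add: gext_def)
    qed
    obtain u where u: "length u = N" "u @ [a] \<in> S" using S_ext_left[OF S_letter[OF True]] by blast
    have "bij (f u)" unfolding f_def using ab(1) t by (intro bij_comp bij_imp_bij_inv)
    then have "bij (k False)" using fk[OF u] by simp
    moreover have "\<alpha> (tl (u @ [a])) (t u a z) = k False (\<alpha> u z)"
      if "length u = N" "u @ [a] \<in> S" for u z
      using fk[OF that] bij_is_inj[OF ab(1)] by (auto simp: f_def fun_eq_iff inv_f_f dest!: spec[of _ "\<alpha> u z"])
    ultimately show ?thesis by blast
  qed
  then have "\<forall>a. \<exists>s. bij s \<and> (\<forall>u z. length u = N \<longrightarrow> u @ [a] \<in> S \<longrightarrow>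
    \<alpha> (tl (u @ [a])) (t u a z) = s (\<alpha> u z))" by blast
  from choice[OF this] obtain \<sigma> where "\<forall>a. bij (\<sigma> a) \<and> (\<forall>u z. length u = N \<longrightarrow> u @ [a] \<in> S \<longrightarrow>
    \<alpha> (tl (u @ [a])) (t u a z) = \<sigma> a (\<alpha> u z))" by blast
  then show ?thesis using ab
    by (intro exI[of _ \<alpha>] exI[of _ \<beta>] exI[of _ \<sigma>]) auto
qed

text \<open>By \<open>tyR_\<theta>\<close>, a letter that can precede \<open>\<theta> a\<close> has
  the opposite type of \<open>a\<close>.\<close>

lemma ex_tyL: "\<exists>a\<in>A. tyL a = i"
proof -
  obtain a where "[a] \<in> S" using S_ext_right[OF Nil_in_S, of 1] by (auto simp: length_Suc_conv)
  from S_lists[OF this] have a: "a \<in> A" by simp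
  obtain b where ab: "[b, \<theta> a] \<in> S"
    using S_ext_left[OF S_letter[of "\<theta> a"], of 1] a by (auto simp: length_Suc_conv)
  have "b \<in> A" using S_lists[OF ab] by simp
  moreover have "tyL b \<longleftrightarrow> \<not> tyL a" using tyL_eq_tyR[OF ab] tyR_\<theta>[OF a] by simp
  ultimately show ?thesis using a by (cases "tyL a = i") auto
qed

end

section \<open>Parsing words over a bifix code\<close>

lemma word_star_Nil [simp]: "[] \<in> word_star X"
  unfolding word_star_def by (intro image_eqI[of _ _ "[]"]) auto

lemma word_star_Cons: "x \<in> X \<Longrightarrow> w \<in> word_star X \<Longrightarrow> x @ w \<in> word_star X"
proof -
  assume "x \<in> X" "w \<in> word_star X"
  then obtain xs where "xs \<in> lists X" "w = concat xs" by (auto simp: word_star_def)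
  then show ?thesis using \<open>x \<in> X\<close> unfolding word_star_def by (intro image_eqI[of _ _ "x # xs"]) auto
qed

text \<open>The intended automaton without windows: \<open>p\<close> is the unfinished code word,
  \<open>g\<close> records the completed ones. The window automaton is compared with it in
  \<open>symmetric_code_action\<close>.\<close>

fun parse_run :: "'a list set \<Rightarrow> ('a list \<Rightarrow> 'c \<Rightarrow> 'c) \<Rightarrow> 'a list \<Rightarrow> 'c \<Rightarrow> 'a list \<Rightarrow> 'a list \<times> 'c" where
  "parse_run X f p g [] = (p, g)"
| "parse_run X f p g (a # v) =
    (if p @ [a] \<in> X then parse_run X f [] (f (p @ [a]) g) v else parse_run X f (p @ [a]) g v)"

lemma parse_run_Nil_word_star: "fst (parse_run X f p g v) = [] \<Longrightarrow> p @ v \<in> word_star X"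
proof (induction v arbitrary: p g)
  case (Cons a v)
  show ?case
  proof (cases "p @ [a] \<in> X")
    case True
    then have "v \<in> word_star X" using Cons.IH[of "[]" "f (p @ [a]) g"] Cons.prems by simp
    then show ?thesis using word_star_Cons[OF True] by simp
  next
    case False
    then show ?thesis using Cons.IH[of "p @ [a]" g] Cons.prems by simp
  qed
qed simp

lemma parse_run_code:
  assumes "bifix_code X" "p @ v \<in> X" "v \<noteq> []"
  shows "parse_run X f p g v = ([], f (p @ v) g)"
  using assms(2,3)
proof (induction v arbitrary: p)
  case (Cons a v)
  show ?case
  proof (cases "v = []")
    case True
    then show ?thesis using Cons.prems by simp
  next
    case False
    then have "strict_prefix (p @ [a]) (p @ a # v)" by (simp add: strict_prefix_def)
    then have "p @ [a] \<notin> X" using assms(1) Cons.prems by (auto simp: bifix_code_def)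
    then show ?thesis using Cons.IH[of "p @ [a]"] Cons.prems False by simp
  qed
qed simp

text \<open>Mapping a parse \<open>(q, x, p)\<close> to \<open>p\<close> is a bijection onto this set (lemma \<open>card_parses\<close>).\<close>

definition live :: "'a list set \<Rightarrow> 'a list \<Rightarrow> 'a list set" where
  "live X u = {p. suffix p u \<and> (\<forall>x\<in>X. \<not> prefix x p)}"

lemma finite_live: "finite (live X u)"
  by (rule finite_subset[of _ "set (suffixes u)"]) (auto simp: live_def)

lemma Nil_live: "bifix_code X \<Longrightarrow> [] \<in> live X u"
  by (auto simp: live_def bifix_code_def)

lemma live_snoc: "p \<in> live X u \<Longrightarrow> p @ [a] \<notin> X \<Longrightarrow> p @ [a] \<in> live X (u @ [a])"
  by (auto simp: live_def)

lemma live_shorter: "p \<in> live X (w @ u) \<Longrightarrow> length p \<le> length u \<Longrightarrow> p \<in> live X u"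
  by (auto simp: live_def) (metis suffix_length_suffix suffix_append suffix_def)

lemma live_append: "p \<in> live X u \<Longrightarrow> p \<in> live X (w @ u)"
  by (auto simp: live_def intro: suffix_appendI)

text \<open>Live words are suffixes of the same \<open>u\<close>, so two of them that complete a
  code word with \<open>a\<close> give suffix-comparable code words, which are equal.\<close>

lemma live_step_extends_bij:
  assumes "bifix_code X"
  shows "\<exists>h. bij h \<and> (\<forall>p\<in>live X u. h p = (if p @ [a] \<in> X then [] else p @ [a]))"
proof (rule inj_on_extend_bij[OF finite_live], rule inj_onI)
  fix p q assume p: "p \<in> live X u" "q \<in> live X u"
    and eq: "(if p @ [a] \<in> X then [] else p @ [a]) = (if q @ [a] \<in> X then [] else q @ [a])"
  show "p = q"
  proof (cases "p @ [a] \<in> X \<and> q @ [a] \<in> X")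
    case True
    have "suffix p q \<or> suffix q p" using p suffix_same_cases by (auto simp: live_def)
    then have "suffix (p @ [a]) (q @ [a]) \<or> suffix (q @ [a]) (p @ [a])" by simp
    then have "p @ [a] = q @ [a]"
      using True assms unfolding bifix_code_def strict_suffix_def by blast
    then show ?thesis by simp
  qed (use eq in \<open>auto split: if_splits\<close>)
qed

section \<open>The action defined by a symmetric bifix code\<close>

context specular_set
begin

lemma word_inv_word_inv [simp]: "w \<in> lists A \<Longrightarrow> word_inv \<theta> (word_inv \<theta> w) = w"
  by (induction w) (auto simp: word_inv_def rev_map)

lemma involution_word_inv:
  assumes "X \<subseteq> S" "symmetric_words \<theta> X"
  shows "involution_on X (word_inv \<theta>)"
  using assms S_lists by (auto simp: involution_on_def symmetric_words_def)

text \<open>The group acts on \<open>bool \<times> fibre\<close>, where the boolean records the tree of the extension graph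
  of the empty word at the current position. A letter \<open>a\<close> acts by \<open>\<sigma> a\<close> if it can be read there,
  and otherwise, by \<open>tyR_\<theta>\<close>, as the inverse of \<open>\<theta> a\<close>. The element \<open>r i g\<close> stands for a position
  where a factorization over \<open>X\<close> may begin, after having read the stack \<open>g\<close> of words of \<open>X\<close>.\<close>

lemma symmetric_code_action:
  assumes X: "X \<subseteq> S" "symmetric_words \<theta> X" "bifix_code X"
    and N: "N \<ge> 1" "\<forall>x\<in>X. length x \<le> N"
  shows "\<exists>(\<tau> :: 'a \<Rightarrow> bool \<times> 'a list \<times> 'a list list \<Rightarrow> bool \<times> 'a list \<times> 'a list list) r.
    (\<forall>u v y. word_cong A \<theta> u v \<longrightarrow> fold \<tau> u y = fold \<tau> v y) \<and>
    (\<forall>i. inj (r i)) \<and>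
    (\<forall>x i g. x \<in> X \<longrightarrow> (\<exists>j. fold \<tau> x (i, r i g) = (j, r j (push X (word_inv \<theta>) x g)))) \<and>
    (\<forall>w g j g'. w \<in> S \<and> w \<noteq> [] \<and> length w \<le> N \<and>
      fold \<tau> w (tyR (hd w), r (tyR (hd w)) g) = (j, r j g') \<longrightarrow> w \<in> word_star X)"
proof -
  let ?\<iota> = "word_inv \<theta>"
  let ?push = "push X ?\<iota>"
  have inv_X: "involution_on X ?\<iota>" by (rule involution_word_inv[OF X(1,2)])
  have "\<forall>ua. \<exists>h. bij h \<and> (\<forall>p\<in>live X (fst ua). h p =
    (if p @ [snd ua] \<in> X then [] else p @ [snd ua]))"
    using live_step_extends_bij[OF X(3)] by blast
  from choice[OF this] obtain \<pi>' where \<pi>': "\<And>ua. bij (\<pi>' ua)"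
    "\<And>ua p. p \<in> live X (fst ua) \<Longrightarrow> \<pi>' ua p = (if p @ [snd ua] \<in> X then [] else p @ [snd ua])" by blast
  define \<pi> where "\<pi> u a = \<pi>' (u, a)" for u a
  have \<pi>: "bij (\<pi> u a)"
    "p \<in> live X u \<Longrightarrow> \<pi> u a p = (if p @ [a] \<in> X then [] else p @ [a])" for u a p
    unfolding \<pi>_def using \<pi>'(1) \<pi>'(2)[of p "(u, a)"] by auto
  \<comment> \<open>A state is an unfinished code word with a stack. \<open>?push\<close> takes
    effect only if \<open>p @ [a]\<close> is in \<open>X\<close>, that is, when a code word is
    completed.\<close>
  define t :: "'a list \<Rightarrow> 'a \<Rightarrow> 'a list \<times> 'a list list \<Rightarrow> 'a list \<times> 'a list list" where
    "t u a = (\<lambda>(p, g). (\<pi> u a p, ?push (p @ [a]) g))" for u a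
  have t: "bij (t u a)" for u a
  proof (rule bijI')
    have inj: "\<pi> u a p = \<pi> u a q \<longleftrightarrow> p = q" "?push x g = ?push x g' \<longleftrightarrow> g = g'" for p q x g g'
      using inj_eq[OF bij_is_inj[OF \<pi>(1)]] inj_eq[OF bij_is_inj[OF bij_push[OF inv_X]]] by blast+
    fix y z show "t u a y = t u a z \<longleftrightarrow> y = z"
      unfolding t_def split_beta prod_eq_iff fst_conv snd_conv inj(1) using inj(2) by metis
  next
    fix z :: "'a list \<times> 'a list list"
    obtain p where p: "\<pi> u a p = fst z" using bij_is_surj[OF \<pi>(1)] by (metis surjD)
    obtain g where "?push (p @ [a]) g = snd z" using bij_is_surj[OF bij_push[OF inv_X]] by (metis surjD)
    then show "\<exists>y. z = t u a y" using p by (intro exI[of _ "(p, g)"]) (simp add: t_def)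
  qed
  \<comment> \<open>The length bound keeps \<open>p\<close> within the window, where
    \<open>\<pi>\<close> follows the automaton.\<close>
  have run_t: "run t u v (p, g) = parse_run X ?push p g v"
    if "length u = N" "p \<in> live X u" "length p + length v \<le> N" for u v p g
    using that
  proof (induction v arbitrary: u p g)
    case (Cons a v)
    have len: "length (tl (u @ [a])) = N" using Cons.prems(1) by simp
    have live: "p @ [a] \<in> live X (tl (u @ [a]))" if "p @ [a] \<notin> X"
      using live_snoc[OF Cons.prems(2) that] live_shorter[of _ X "[hd (u @ [a])]" "tl (u @ [a])"]
        Cons.prems(3) len by simp
    show ?case
    proof (cases "p @ [a] \<in> X")
      case True
      then show ?thesis
        using Cons.IH[OF len Nil_live[OF X(3)]] Cons.prems \<pi>(2)[OF Cons.prems(2)] by (simp add: t_def)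
    next
      case False
      then show ?thesis
        using Cons.IH[OF len live] Cons.prems \<pi>(2)[OF Cons.prems(2)] by (simp add: t_def push_def)
    qed
  qed simp
  from cocycle[of t, OF t N(1)]
  obtain \<alpha> \<beta> :: "'a list \<Rightarrow> 'a list \<times> 'a list list \<Rightarrow> 'a list \<times> 'a list list" and
    \<sigma> :: "'a \<Rightarrow> 'a list \<times> 'a list list \<Rightarrow> 'a list \<times> 'a list list" where
    \<alpha>: "\<And>u. bij (\<alpha> u)" and \<sigma>: "\<And>a. bij (\<sigma> a)"
    and \<beta>: "\<And>u v z. (u, v) \<in> gext S N N [] \<Longrightarrow> \<beta> v (run t u v z) = \<alpha> u z"
    and \<alpha>\<sigma>: "\<And>u a z. length u = N \<Longrightarrow> u @ [a] \<in> S \<Longrightarrow> \<alpha> (tl (u @ [a])) (t u a z) = \<sigma> a (\<alpha> u z)"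
    by blast

  \<comment> \<open>From an empty unfinished part, the result of reading \<open>v\<close> does not
    depend on \<open>u\<close>. So connectedness applies and gives \<open>r\<close>.\<close>
  have "(\<lambda>g. \<alpha> u ([], g)) = (\<lambda>g. \<beta> v (parse_run X ?push [] g v))" if "(u, v) \<in> gext S N N []" for u v
  proof
    fix g show "\<alpha> u ([], g) = \<beta> v (parse_run X ?push [] g v)"
      using \<beta>[OF that, of "([], g)"] run_t[OF _ Nil_live[OF X(3)], of u v g] that
      by (simp add: gext_def)
  qed
  from gext_const[OF Nil_in_S N(1), of "\<lambda>u g. \<alpha> u ([], g)"
    "\<lambda>v g. \<beta> v (parse_run X ?push [] g v)", OF this] obtain r where
    r: "\<And>u v. (u, v) \<in> gext S N N [] \<Longrightarrow> (\<lambda>g. \<alpha> u ([], g)) = r (tyR (hd v))" by auto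
  have \<alpha>_Nil: "\<alpha> u ([], g) = r (tyL (last u)) g" if u: "u \<in> S" "length u = N" for u g
  proof -
    obtain v where v: "length v = N" "u @ v \<in> S" using S_ext_right[OF u(1)] by blast
    obtain u' b where u': "u = u' @ [b]" using u N(1) by (cases u rule: rev_cases) auto
    obtain c v' where v': "v = c # v'" using v N(1) by (cases v) auto
    have "[b, c] \<in> S" using v(2) S_factor[of u' "[b, c]" v'] u' v' by simp
    then show ?thesis using r[of u v] u v u' v' tyL_eq_tyR[of b c] by (simp add: gext_def fun_eq_iff)
  qed
  have inj_r: "inj (r i)" for i
  proof -
    obtain a where a: "a \<in> A" "tyL a = i" using ex_tyL by blast
    obtain u' where "length u' = N - 1" "u' @ [a] \<in> S" using S_ext_left[OF S_letter[OF a(1)]] by blast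
    then have "\<alpha> (u' @ [a]) ([], g) = r i g" for g using \<alpha>_Nil[of "u' @ [a]"] N(1) a by simp
    then have "r i = (\<lambda>g. \<alpha> (u' @ [a]) ([], g))" by auto
    then show ?thesis using bij_is_inj[OF \<alpha>] by (auto simp: inj_def)
  qed
  have fold_\<sigma>: "fold \<sigma> w (\<alpha> u z) = \<alpha> (drop (length w) (u @ w)) (run t u w z)"
    if "length u = N" "u @ w \<in> S" for u w z
    using that
  proof (induction w arbitrary: u z)
    case (Cons a w)
    have "u \<noteq> []" using Cons.prems(1) N(1) by auto
    have ua: "u @ [a] \<in> S" using Cons.prems S_prefix[of "u @ [a]" w] by simp
    have "tl (u @ [a]) @ w \<in> S"
      using Cons.prems S_suffix[of "[hd u]" "tl u @ a # w"] \<open>u \<noteq> []\<close> by (cases u) auto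
    from Cons.IH[OF _ this, of "t u a z"] show ?case
      using \<alpha>\<sigma>[OF Cons.prems(1) ua, of z] Cons.prems(1) drop_Suc_snoc[OF \<open>u \<noteq> []\<close>, of "length w" a w]
      by (simp del: drop_append)
  qed simp

  define \<tau> where "\<tau> a = (\<lambda>(i, f). if i = tyR a then (tyL a, \<sigma> a f)
    else (\<not> tyL a, finv (\<sigma> (\<theta> a)) f))" for a
  have \<tau>\<theta>: "\<tau> (\<theta> a) (\<tau> a y) = y" if "a \<in> A" for a y
    using that tyR_\<theta>[OF that] tyR_\<theta>[of "\<theta> a"] bij_is_inj[OF \<sigma>] bij_is_surj[OF \<sigma>]
    by (cases y) (auto simp: \<tau>_def surj_f_inv_f)
  have cong: "fold \<tau> u y = fold \<tau> v y" if "word_cong A \<theta> u v" for u v y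
    using that by (induction arbitrary: y rule: word_cong.induct) (auto simp: \<tau>\<theta>)
  have fold_\<tau>: "fold \<tau> w (tyR (hd w), f) = (tyL (last w), fold \<sigma> w f)" if "w \<in> S" "w \<noteq> []" for w f
    using that
  proof (induction w arbitrary: f)
    case (Cons a w)
    show ?case
    proof (cases "w = []")
      case False
      then obtain b w' where w: "w = b # w'" by (cases w) auto
      have "[a, b] \<in> S" using S_prefix[of "[a, b]" w'] Cons.prems w by simp
      then show ?thesis
        using Cons.IH S_suffix[of "[a]" w] Cons.prems False tyL_eq_tyR[of a b] w by (simp add: \<tau>_def)
    qed (simp add: \<tau>_def)
  qed simp
  \<comment> \<open>A left extension of \<open>w\<close> supplies the window before
    \<open>w\<close>; the \<open>u\<close> of the claim is the window after
    \<open>w\<close>.\<close>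
  have fold_r: "\<exists>u. fold \<tau> w (tyR (hd w), r (tyR (hd w)) g) =
      (tyL (last w), \<alpha> u (parse_run X ?push [] g w)) \<and>
      (\<forall>g. \<alpha> u ([], g) = r (tyL (last w)) g)"
    if w: "w \<in> S" "w \<noteq> []" "length w \<le> N" for w g
  proof -
    obtain u where u: "length u = N" "u @ w \<in> S" using S_ext_left[OF w(1)] by blast
    obtain u' b where u': "u = u' @ [b]" using u N(1) by (cases u rule: rev_cases) auto
    have bw: "[b, hd w] \<in> S" using u(2) u' w(2) S_factor[of u' "[b, hd w]" "tl w"] by simp
    have "\<alpha> u ([], g) = r (tyR (hd w)) g"
      using \<alpha>_Nil[of u] u S_prefix[of u w] u' tyL_eq_tyR[OF bw] by simp
    then have "fold \<tau> w (tyR (hd w), r (tyR (hd w)) g) = (tyL (last w), fold \<sigma> w (\<alpha> u ([], g)))"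
      using fold_\<tau>[OF w(1,2)] by simp
    also have "\<dots> = (tyL (last w), \<alpha> (drop (length w) (u @ w)) (parse_run X ?push [] g w))"
      using fold_\<sigma>[OF u] run_t[OF u(1) Nil_live[OF X(3)]] w(3) by (simp del: drop_append)
    finally have 1: "fold \<tau> w (tyR (hd w), r (tyR (hd w)) g) =
      (tyL (last w), \<alpha> (drop (length w) (u @ w)) (parse_run X ?push [] g w))" .
    have "drop (length w) (u @ w) \<in> S"
      using u(2) S_suffix[of "take (length w) (u @ w)" "drop (length w) (u @ w)"]
      by (simp del: drop_append take_append)
    moreover have "length (drop (length w) (u @ w)) = N" using u by simp
    moreover have "last (drop (length w) (u @ w)) = last w" using u w N(1) by (subst last_drop) auto
    ultimately show ?thesis using 1 \<alpha>_Nil by (intro exI[of _ "drop (length w) (u @ w)"]) simp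
  qed
  have forward: "fold \<tau> x (tyR (hd x), r (tyR (hd x)) g) = (tyL (last x), r (tyL (last x)) (?push x g))"
    if "x \<in> X" for x g
  proof -
    have "x \<noteq> []" using that X(3) by (auto simp: bifix_code_def)
    then show ?thesis
      using fold_r[OF subsetD[OF X(1) that], of g] that N(2) parse_run_code[OF X(3), of "[]" x ?push g]
      by auto
  qed
  have "\<exists>j. fold \<tau> x (i, r i g) = (j, r j (?push x g))" if x: "x \<in> X" for x i g
  proof (cases "i = tyR (hd x)")
    case True
    then show ?thesis using forward[OF x] by blast
  next
    case False
    have ne: "x \<noteq> []" using x X(3) by (auto simp: bifix_code_def)
    have xA: "x \<in> lists A" using x X(1) S_lists by blast
    have x': "?\<iota> x \<in> X" using x X(2) by (simp add: symmetric_words_def)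
    have hd: "hd x \<in> A" using xA ne by (cases x) auto
    \<comment> \<open>At a position of the other type, \<open>x\<close> acts as the inverse of
      \<open>?\<iota> x\<close>, which can be read so as to end in type \<open>i\<close> and takes
      the stack \<open>?push x g\<close> to \<open>g\<close>.\<close>
    have "last (?\<iota> x) = \<theta> (hd x)" using ne by (simp add: word_inv_def last_rev hd_map)
    then have "tyL (last (?\<iota> x)) = i" using False tyR_\<theta>[of "\<theta> (hd x)"] hd by auto
    then have "fold \<tau> (?\<iota> x) (tyR (hd (?\<iota> x)), r (tyR (hd (?\<iota> x))) (?push x g)) = (i, r i g)"
      using forward[OF x', of "?push x g"] push_push[OF inv_X x] by simp
    then have "fold \<tau> x (i, r i g) =
      fold \<tau> (?\<iota> x @ x) (tyR (hd (?\<iota> x)), r (tyR (hd (?\<iota> x))) (?push x g))" by simp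
    also have "\<dots> = (tyR (hd (?\<iota> x)), r (tyR (hd (?\<iota> x))) (?push x g))"
      using cong[OF word_cong_inv[OF inv_\<theta> xA]] by simp
    finally show ?thesis by blast
  qed
  moreover have "w \<in> word_star X"
    if "w \<in> S" "w \<noteq> []" "length w \<le> N" "fold \<tau> w (tyR (hd w), r (tyR (hd w)) g) = (j, r j g')"
    for w g j g'
  proof -
    from fold_r[OF that(1-3), of g] obtain u where u:
      "fold \<tau> w (tyR (hd w), r (tyR (hd w)) g) = (tyL (last w), \<alpha> u (parse_run X ?push [] g w))"
      "\<And>g. \<alpha> u ([], g) = r (tyL (last w)) g" by blast
    then have "\<alpha> u (parse_run X ?push [] g w) = \<alpha> u ([], g')" using that(4) by auto
    \<comment> \<open>Injectivity of \<open>\<alpha> u\<close> shows that no unfinished code word is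
      left after \<open>w\<close>.\<close>
    then have "parse_run X ?push [] g w = ([], g')" using bij_is_inj[OF \<alpha>] by (simp add: inj_eq)
    then show ?thesis using parse_run_Nil_word_star[of X ?push "[]" g w] by simp
  qed
  ultimately show ?thesis using cong inj_r
    by (intro exI[of _ \<tau>] exI[of _ r]) blast
qed

lemma fold_concat_code:
  assumes "\<And>x i g. x \<in> X \<Longrightarrow> \<exists>j. fold \<tau> x (i, r i g) = (j, r j (f x g))" "xs \<in> lists X"
  shows "\<exists>j. fold \<tau> (concat xs) (i, r i g) = (j, r j (fold f xs g))"
  using assms(2)
proof (induction xs arbitrary: i g)
  case (Cons x xs)
  then show ?case using assms(1)[of x i g] by auto
qed simp

text \<open>A product of code words moves \<open>r i g\<close> to some \<open>r j g'\<close>. Since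
  \<open>w\<close> acts in the same way, reading it leaves no unfinished code word. The window
  length must also bound \<open>length w\<close>.\<close>

lemma saturation:
  assumes X: "X \<subseteq> S" "symmetric_words \<theta> X" "bifix_code X" "finite X"
    and xs: "xs \<in> lists X" and w: "w \<in> S" "word_cong A \<theta> (concat xs) w"
  shows "w \<in> word_star X"
proof (cases "w = []")
  case False
  define N where "N = Max (insert 1 (insert (length w) (length ` X)))"
  have N: "N \<ge> 1" "\<forall>x\<in>X. length x \<le> N" "length w \<le> N" using X(4) unfolding N_def by (auto intro!: Max_ge simp del: Max_insert)
  from symmetric_code_action[OF X(1-3) N(1,2)]
  obtain \<tau> :: "'a \<Rightarrow> bool \<times> 'a list \<times> 'a list list \<Rightarrow> bool \<times> 'a list \<times> 'a list list" and r where
    \<tau>: "\<And>u v y. word_cong A \<theta> u v \<Longrightarrow> fold \<tau> u y = fold \<tau> v y"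
    "\<And>x i g. x \<in> X \<Longrightarrow> \<exists>j. fold \<tau> x (i, r i g) = (j, r j (push X (word_inv \<theta>) x g))"
    "\<And>w g j g'. w \<in> S \<Longrightarrow> w \<noteq> [] \<Longrightarrow> length w \<le> N \<Longrightarrow>
      fold \<tau> w (tyR (hd w), r (tyR (hd w)) g) = (j, r j g') \<Longrightarrow> w \<in> word_star X"
    by blast
  from fold_concat_code[of X \<tau> r, OF \<tau>(2) xs, of "tyR (hd w)" "[]"]
  show ?thesis using \<tau>(1)[OF w(2)] \<tau>(3)[OF w(1) False N(3)] by metis
qed simp

text \<open>A product equal to 1 acts trivially, so by injectivity of \<open>r True\<close> it
  returns the empty stack to itself; but a reduced \<open>xs\<close> leaves its reversal.\<close>

lemma freeness:
  assumes X: "X \<subseteq> S" "symmetric_words \<theta> X" "bifix_code X" "finite X"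
    and xs: "xs \<in> lists X" "successively (\<lambda>x y. y \<noteq> word_inv \<theta> x) xs" "word_cong A \<theta> (concat xs) []"
  shows "xs = []"
proof -
  define N where "N = Max (insert 1 (length ` X))"
  have N: "N \<ge> 1" "\<forall>x\<in>X. length x \<le> N" using X(4) unfolding N_def by (auto intro!: Max_ge simp del: Max_insert)
  from symmetric_code_action[OF X(1-3) N(1,2)]
  obtain \<tau> :: "'a \<Rightarrow> bool \<times> 'a list \<times> 'a list list \<Rightarrow> bool \<times> 'a list \<times> 'a list list" and r where
    \<tau>: "\<And>u v y. word_cong A \<theta> u v \<Longrightarrow> fold \<tau> u y = fold \<tau> v y" "\<And>i. inj (r i)"
    "\<And>x i g. x \<in> X \<Longrightarrow> \<exists>j. fold \<tau> x (i, r i g) = (j, r j (push X (word_inv \<theta>) x g))"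
    by blast
  from fold_concat_code[of X \<tau> r, OF \<tau>(3) xs(1), of True "[]"]
  have "r True [] = r True (fold (push X (word_inv \<theta>)) xs [])" using \<tau>(1)[OF xs(3)] by auto
  then have "fold (push X (word_inv \<theta>)) xs [] = []" using \<tau>(2) by (simp add: inj_eq)
  then show ?thesis using fold_push[OF involution_word_inv[OF X(1,2)] xs(1,2)] by simp
qed

end

section \<open>Degree and index\<close>

lemma word_star_snoc: "w \<in> word_star X \<Longrightarrow> x \<in> X \<Longrightarrow> w @ x \<in> word_star X"
proof -
  assume "x \<in> X" "w \<in> word_star X"
  then obtain xs where "xs \<in> lists X" "w = concat xs" by (auto simp: word_star_def)
  then show ?thesis using \<open>x \<in> X\<close> unfolding word_star_def by (intro image_eqI[of _ _ "xs @ [x]"]) auto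
qed

lemma word_star_prefix: "w \<in> word_star X \<Longrightarrow> w \<noteq> [] \<Longrightarrow> \<exists>x\<in>X. prefix x w"
proof -
  assume "w \<in> word_star X" "w \<noteq> []"
  then obtain xs where "xs \<in> lists X" "w = concat xs" by (auto simp: word_star_def)
  moreover obtain x xs' where "xs = x # xs'" using calculation \<open>w \<noteq> []\<close> by (cases xs) auto
  ultimately show ?thesis by (intro bexI[of _ x]) auto
qed

lemma left_parse_exists:
  assumes "bifix_code X"
  shows "\<exists>q x. w = q @ x \<and> (\<forall>u\<in>X. \<not> suffix u q) \<and> x \<in> word_star X"
proof (induction w rule: length_induct)
  case (1 w)
  show ?case
  proof (cases "\<exists>u\<in>X. suffix u w")
    case False
    then show ?thesis by (intro exI[of _ w] exI[of _ "[]"]) simp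
  next
    case True
    then obtain u w' where u: "u \<in> X" "w = w' @ u" by (auto simp: suffix_def)
    then have "length w' < length w" using assms by (auto simp: bifix_code_def)
    then obtain q x where "w' = q @ x" "\<forall>u\<in>X. \<not> suffix u q" "x \<in> word_star X" using 1 by blast
    then show ?thesis using u word_star_snoc by (intro exI[of _ q] exI[of _ "x @ u"]) simp
  qed
qed

text \<open>The last code words on both sides are suffix-comparable, hence equal. A code word left
  over on one side only would be a suffix of \<open>q\<close> or \<open>q'\<close>.\<close>

lemma left_parse_unique:
  assumes "bifix_code X" "\<forall>u\<in>X. \<not> suffix u q" "\<forall>u\<in>X. \<not> suffix u q'"
    "xs \<in> lists X" "ys \<in> lists X" "q @ concat xs = q' @ concat ys"
  shows "xs = ys"
  using assms(4-6)
proof (induction xs arbitrary: ys rule: rev_induct)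
  case Nil
  show ?case
  proof (cases ys rule: rev_cases)
    case (snoc zs z)
    then have "suffix z q" using Nil.prems by (auto simp: suffix_def)
    then show ?thesis using assms(2) Nil.prems snoc by auto
  qed simp
next
  case (snoc x xs)
  show ?case
  proof (cases ys rule: rev_cases)
    case Nil
    then have "suffix x q'" using snoc.prems by (auto simp: suffix_def)
    then show ?thesis using assms(3) snoc.prems by auto
  next
    case (snoc zs z)
    have eq: "(q @ concat xs) @ x = (q' @ concat zs) @ z" using snoc.prems snoc by simp
    have "suffix x ((q @ concat xs) @ x)" by (simp add: suffix_def)
    moreover have "suffix z ((q @ concat xs) @ x)" unfolding eq by (simp add: suffix_def)
    ultimately have "suffix x z \<or> suffix z x" using suffix_same_cases by blast
    moreover have "x \<in> X" "z \<in> X" using snoc.prems snoc by auto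
    ultimately have "x = z" using assms(1) unfolding bifix_code_def strict_suffix_def by blast
    then show ?thesis using snoc.IH[of zs] snoc.prems snoc eq by simp
  qed
qed

text \<open>The part of \<open>w\<close> before \<open>p\<close> splits in exactly one way into
  \<open>q @ x\<close>.\<close>

lemma card_parses:
  assumes "bifix_code X"
  shows "card (parses X w) = card (live X w)"
proof (rule bij_betw_same_card[of "\<lambda>(q, x, p). p"])
  have "inj_on (\<lambda>(q, x, p). p) (parses X w)"
  proof (rule inj_onI)
    fix s s' assume a: "s \<in> parses X w" "s' \<in> parses X w"
      and eq: "(\<lambda>(q, x, p). p) s = (\<lambda>(q, x, p). p) s'"
    obtain q x p q' x' where s: "s = (q, x, p)" "s' = (q', x', p)"
      using eq by (cases s; cases s') auto
    obtain xs ys where xs: "xs \<in> lists X" "x = concat xs" "ys \<in> lists X" "x' = concat ys"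
      using a s by (auto simp: parses_def word_star_def)
    have "q @ x = q' @ x'" using a s by (auto simp: parses_def)
    then show "s = s'" using left_parse_unique[OF assms, of q q' xs ys] a s xs
      by (auto simp: parses_def)
  qed
  moreover have "(\<lambda>(q, x, p). p) ` parses X w = live X w"
  proof
    show "(\<lambda>(q, x, p). p) ` parses X w \<subseteq> live X w" by (auto simp: parses_def live_def suffix_def)
    show "live X w \<subseteq> (\<lambda>(q, x, p). p) ` parses X w"
    proof
      fix p assume p: "p \<in> live X w"
      then obtain w' where w: "w = w' @ p" by (auto simp: live_def suffix_def)
      obtain q x where "w' = q @ x" "\<forall>u\<in>X. \<not> suffix u q" "x \<in> word_star X"
        using left_parse_exists[OF assms] by blast
      then have "(q, x, p) \<in> parses X w" using p w by (auto simp: parses_def live_def)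
      then show "p \<in> (\<lambda>(q, x, p). p) ` parses X w" by force
    qed
  qed
  ultimately show "bij_betw (\<lambda>(q, x, p). p) (parses X w) (live X w)" by (simp add: bij_betw_def)
qed

lemma has_degree_unique: "has_degree S X d \<Longrightarrow> has_degree S X e \<Longrightarrow> d = e"
  unfolding has_degree_def by (metis le_antisym)

lemma prefix_word_inv: "suffix u v \<Longrightarrow> prefix (word_inv \<theta> u) (word_inv \<theta> v)"
  and suffix_word_inv: "prefix u v \<Longrightarrow> suffix (word_inv \<theta> u) (word_inv \<theta> v)"
  by (auto simp: word_inv_def suffix_def prefix_def)

lemma word_inv_concat: "word_inv \<theta> (concat xs) = concat (rev (map (word_inv \<theta>) xs))"
  by (induction xs) (auto simp: word_inv_def)

text \<open>The link between degree and index: in \<open>specular_code\<close> it is equivalent to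
  maximality, follows from finite index and determines the degree.\<close>

definition complete_code :: "'a list set \<Rightarrow> 'a list set \<Rightarrow> bool" where
  "complete_code S X \<longleftrightarrow> (\<forall>w\<in>S. \<exists>x\<in>X. prefix w x \<or> prefix x w)"

section \<open>The subgroup generated by the code and its cosets\<close>

locale specular_code = specular_set +
  fixes X :: "'a list set"
  assumes recurrent: "recurrent_set A S" and X_S: "X \<subseteq> S" and finite_X: "finite X"
    and symmetric: "symmetric_words \<theta> X" and bifix: "bifix_code X"
begin

abbreviation "G \<equiv> G_theta A \<theta>"
abbreviation "E \<equiv> elt A \<theta>"

text \<open>The submonoid generated by \<open>X\<close>, a subgroup because \<open>X\<close> is
  symmetric.\<close>

definition H :: "'a list set set" where "H = E ` word_star X"

lemma group_G: "group G"
  by (rule group_G_theta[OF inv_\<theta>])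

lemma X_lists: "x \<in> X \<Longrightarrow> x \<in> lists A"
  using X_S S_lists by blast

lemma X_inv: "x \<in> X \<Longrightarrow> word_inv \<theta> x \<in> X"
  using symmetric by (simp add: symmetric_words_def)

lemma concat_lists: "xs \<in> lists X \<Longrightarrow> concat xs \<in> lists A"
  by (induction xs) (auto dest: X_lists)

lemma word_star_lists: "w \<in> word_star X \<Longrightarrow> w \<in> lists A"
  using concat_lists by (auto simp: word_star_def)

lemma S_recurrent: "u \<in> S \<Longrightarrow> w \<in> S \<Longrightarrow> \<exists>v. u @ v @ w \<in> S"
  using recurrent unfolding recurrent_set_def by blast

lemma list_prod_map_E: "xs \<in> lists X \<Longrightarrow> list_prod G (map E xs) = E (concat xs)"
proof (induction xs)
  case (Cons x xs)
  then show ?case using mult_elt[of x A "concat xs" \<theta>] X_lists concat_lists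
    by (simp add: list_prod_def)
qed (simp add: list_prod_def one_elt)

lemma list_prod_eq_H: "list_prod G ` lists (E ` X) = H"
proof -
  have "list_prod G ` lists (E ` X) = (\<lambda>xs. E (concat xs)) ` lists X"
    unfolding lists_image image_image using list_prod_map_E by (intro image_cong) auto
  then show ?thesis by (simp add: H_def word_star_def image_image)
qed

lemma subgroup_H: "subgroup H G"
proof (rule group.subgroupI[OF group_G])
  show "H \<subseteq> carrier G" by (auto simp: H_def intro!: elt_carrier word_star_lists)
  show "H \<noteq> {}" using word_star_Nil[of X] unfolding H_def by blast
  fix a assume "a \<in> H"
  then obtain xs where xs: "xs \<in> lists X" "a = E (concat xs)" by (auto simp: H_def word_star_def)
  have "rev (map (word_inv \<theta>) xs) \<in> lists X" using xs X_inv by auto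
  then have "E (word_inv \<theta> (concat xs)) \<in> H"
    unfolding word_inv_concat H_def word_star_def by blast
  then show "inv\<^bsub>G\<^esub> a \<in> H" using inv_elt[OF inv_\<theta> concat_lists] xs by simp
  fix b assume "b \<in> H"
  then obtain ys where ys: "ys \<in> lists X" "b = E (concat ys)" by (auto simp: H_def word_star_def)
  have "a \<otimes>\<^bsub>G\<^esub> b = E (concat (xs @ ys))" using xs ys mult_elt[OF concat_lists concat_lists] by simp
  moreover have "xs @ ys \<in> lists X" using xs ys by auto
  ultimately show "a \<otimes>\<^bsub>G\<^esub> b \<in> H" unfolding H_def word_star_def by blast
qed

lemma H_carrier: "H \<subseteq> carrier G"
  using subgroup.subset[OF subgroup_H] .

lemma E_inv: "w \<in> lists A \<Longrightarrow> E w \<otimes>\<^bsub>G\<^esub> E (word_inv \<theta> w) = \<one>\<^bsub>G\<^esub>"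
  using group.r_inv[OF group_G elt_carrier] inv_elt[OF inv_\<theta>] by metis

text \<open>Neighbours whose product is not 1 are not inverse words, so \<open>freeness\<close>
  applies.\<close>

lemma monoidal_basis_H: "monoidal_basis G H (E ` X)"
  unfolding monoidal_basis_def
proof (intro conjI ballI impI)
  show "E ` X \<subseteq> H" using word_star_Cons[of _ X "[]"] by (auto simp: H_def)
  show "inv\<^bsub>G\<^esub> x \<in> E ` X" if "x \<in> E ` X" for x
    using that inv_elt[OF inv_\<theta> X_lists] X_inv by auto
  show "list_prod G ` lists (E ` X) = H" by (rule list_prod_eq_H)
  fix ys assume "ys \<in> lists (E ` X)"
    and ys: "ys \<noteq> [] \<and> (\<forall>k. Suc k < length ys \<longrightarrow> ys ! k \<otimes>\<^bsub>G\<^esub> ys ! Suc k \<noteq> \<one>\<^bsub>G\<^esub>)"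
  then obtain xs where xs: "xs \<in> lists X" "ys = map E xs" by (auto simp: lists_image)
  have "xs ! Suc k \<noteq> word_inv \<theta> (xs ! k)" if "Suc k < length xs" for k
  proof
    assume eq: "xs ! Suc k = word_inv \<theta> (xs ! k)"
    have "xs ! k \<in> lists A" using xs that X_lists by (metis Suc_lessD in_listsD nth_mem)
    then have "ys ! k \<otimes>\<^bsub>G\<^esub> ys ! Suc k = \<one>\<^bsub>G\<^esub>" using E_inv that xs eq by simp
    then show False using ys that xs by simp
  qed
  then have "successively (\<lambda>x y. y \<noteq> word_inv \<theta> x) xs" by (auto simp: successively_conv_nth)
  then have "\<not> word_cong A \<theta> (concat xs) []"
    using freeness[OF X_S symmetric bifix finite_X xs(1)] ys xs(2) by auto
  then have "E (concat xs) \<noteq> E []" using elt_eq_iff[of "[]" A \<theta> "concat xs"] by simp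
  then show "list_prod G ys \<noteq> \<one>\<^bsub>G\<^esub>"
    unfolding xs(2) list_prod_map_E[OF xs(1)] one_elt .
qed

text \<open>The products over a monoidal basis fill its group, so the theorem need only be examined
  for \<open>H\<close>.\<close>

lemma monoidal_basis_imp_eq_H: "monoidal_basis G K (E ` X) \<Longrightarrow> K = H"
  using list_prod_eq_H by (auto simp: monoidal_basis_def)

lemma E_in_H: "w \<in> S \<Longrightarrow> E w \<in> H \<Longrightarrow> w \<in> word_star X"
proof -
  assume w: "w \<in> S" "E w \<in> H"
  then obtain xs where xs: "xs \<in> lists X" "E (concat xs) = E w" by (auto simp: H_def word_star_def)
  then have "word_cong A \<theta> (concat xs) w" using elt_eq_iff[OF S_lists[OF w(1)]] by blast
  then show ?thesis using saturation[OF X_S symmetric bifix finite_X xs(1) w(1)] by blast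
qed

definition C :: "'a list \<Rightarrow> 'a list set set" where "C w = H #>\<^bsub>G\<^esub> E w"

lemma C_append: "u \<in> lists A \<Longrightarrow> v \<in> lists A \<Longrightarrow> C (u @ v) = C u #>\<^bsub>G\<^esub> E v"
  unfolding C_def
  using group.coset_mult_assoc[OF group_G H_carrier elt_carrier elt_carrier] mult_elt by metis

lemma C_Nil: "C [] = H"
  unfolding C_def using group.coset_mult_one[OF group_G H_carrier] by (simp add: one_elt)

lemma C_absorb: "u \<in> lists A \<Longrightarrow> v \<in> lists A \<Longrightarrow> E u \<in> H \<Longrightarrow> C (u @ v) = C v"
  using C_append group.coset_join2[OF group_G elt_carrier subgroup_H] unfolding C_def by metis

lemma C_cancel:
  assumes "u \<in> lists A" "v \<in> lists A" "w \<in> lists A" "C (u @ w) = C (v @ w)"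
  shows "C u = C v"
proof -
  have "C u = C (u @ w) #>\<^bsub>G\<^esub> inv\<^bsub>G\<^esub> E w" if "u \<in> lists A" for u
    unfolding C_append[OF that assms(3)] unfolding C_def
    using group.coset_mult_assoc[OF group_G H_carrier, of "E u \<otimes>\<^bsub>G\<^esub> E w" "inv\<^bsub>G\<^esub> E w"]
      group.coset_mult_assoc[OF group_G H_carrier, of "E u" "E w"]
      group.inv_closed[OF group_G] group.r_inv[OF group_G] group.is_monoid[OF group_G]
      elt_carrier[OF that] elt_carrier[OF assms(3)]
    by (simp add: monoid.m_closed monoid.m_assoc monoid.r_one)
  then show ?thesis using assms by metis
qed

lemma C_eqD:
  assumes "t \<in> lists A" "q \<in> lists A" "C (t @ q) = C q"
  shows "E t \<in> H"
proof -
  have "C t = C []" using C_cancel[of t "[]" q] assms by simp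
  then have "H #>\<^bsub>G\<^esub> E t = H" using C_Nil by (simp add: C_def)
  then show ?thesis using group.coset_join1[OF group_G _ elt_carrier[OF assms(1), of \<theta>] subgroup_H]
    by blast
qed

lemma rcosets_eq: "rcosets\<^bsub>G\<^esub> H = C ` lists A"
  by (auto simp: RCOSETS_def G_theta_def C_def)

section \<open>Maximality, completeness and finite index\<close>

lemma complete_imp_maximal:
  assumes "complete_code S X"
  shows "maximal_bifix_code S X"
  unfolding maximal_bifix_code_def
proof (intro conjI allI impI notI)
  fix Y assume Y: "bifix_code Y \<and> Y \<subseteq> S" "X \<subset> Y"
  then obtain y where y: "y \<in> Y" "y \<notin> X" by blast
  then obtain x where "x \<in> X" "prefix y x \<or> prefix x y"
    using assms Y unfolding complete_code_def by blast
  then show False using Y y unfolding bifix_code_def strict_prefix_def by blast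
qed (rule bifix X_S)+

text \<open>By maximality every nonempty word of \<open>S\<close> is prefix- or suffix-comparable
  with \<open>X\<close>. A word violating completeness forces all of them to be suffix-comparable,
  and taking inverses makes them prefix-comparable.\<close>

lemma maximal_imp_complete:
  assumes "maximal_bifix_code S X"
  shows "complete_code S X"
proof (rule ccontr)
  let ?pc = "\<lambda>w. \<exists>x\<in>X. prefix w x \<or> prefix x w"
  let ?sc = "\<lambda>w. \<exists>x\<in>X. suffix w x \<or> suffix x w"
  assume "\<not> complete_code S X"
  then obtain z where z: "z \<in> S" "\<not> ?pc z" by (auto simp: complete_code_def)
  have comparable: "?pc w \<or> ?sc w" if "w \<in> S" "w \<noteq> []" for w
  proof (rule ccontr)
    assume "\<not> (?pc w \<or> ?sc w)"
    then have n: "\<And>x. x \<in> X \<Longrightarrow> \<not> prefix w x \<and> \<not> prefix x w \<and> \<not> suffix w x \<and> \<not> suffix x w" by blast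
    then have "bifix_code (insert w X)" using bifix that
      unfolding bifix_code_def strict_prefix_def strict_suffix_def by blast
    moreover have "w \<notin> X" using n by blast
    ultimately show False using assms that X_S unfolding maximal_bifix_code_def by blast
  qed
  \<comment> \<open>If \<open>z\<close> is not prefix-comparable, no extension \<open>z v w\<close> is, so \<open>w\<close> is suffix-comparable.\<close>
  have sc: "?sc w" if w: "w \<in> S" "w \<noteq> []" for w
  proof -
    obtain v where v: "z @ v @ w \<in> S" using S_recurrent[OF z(1) w(1)] by blast
    have "\<not> ?pc (z @ v @ w)"
      using z(2) prefix_same_cases[of _ "z @ v @ w" z] append_prefixD[of z] by (meson prefixI)
    then obtain x where x: "x \<in> X" "suffix (z @ v @ w) x \<or> suffix x (z @ v @ w)"
      using comparable[OF v] w by auto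
    moreover have "suffix w (z @ v @ w)" by (simp add: suffix_def)
    ultimately show ?thesis using suffix_same_cases suffix_order.trans by metis
  qed
  have pc: "?pc w" if w: "w \<in> S" "w \<noteq> []" for w
  proof -
    have "word_inv \<theta> w \<noteq> []" using w by (simp add: word_inv_def)
    then obtain x where x: "x \<in> X" "suffix (word_inv \<theta> w) x \<or> suffix x (word_inv \<theta> w)"
      using sc[OF S_inv[OF w(1)]] by blast
    then have "prefix w (word_inv \<theta> x) \<or> prefix (word_inv \<theta> x) w"
      using prefix_word_inv[of "word_inv \<theta> w" x \<theta>] prefix_word_inv[of x "word_inv \<theta> w" \<theta>]
        S_lists[OF w(1)] by auto
    then show ?thesis using X_inv[OF x(1)] by blast
  qed
  \<comment> \<open>This provides some code word, which settles the case
    \<open>z = []\<close>.\<close>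
  obtain a where "[a] \<in> S" using S_ext_right[OF Nil_in_S, of 1] by (auto simp: length_Suc_conv)
  then obtain x where "x \<in> X" using pc by blast
  then show False using z pc by (cases "z = []") auto
qed

text \<open>If \<open>z\<close> is not comparable with \<open>X\<close>, then the words \<open>W k\<close>, built by recurrence with
  \<open>W (k + 1) \<in> z A\<^sup>* W k\<close>, lie in distinct cosets: otherwise a word of \<open>z A\<^sup>* \<inter> S\<close> would lie in \<open>H\<close>, hence
  in \<open>X\<^sup>*\<close>.\<close>

lemma finite_index_imp_complete:
  assumes fin: "finite (rcosets\<^bsub>G\<^esub> H)"
  shows "complete_code S X"
proof (rule ccontr)
  let ?pc = "\<lambda>w. \<exists>x\<in>X. prefix w x \<or> prefix x w"
  assume "\<not> complete_code S X"
  then obtain z' where z': "z' \<in> S" "\<not> ?pc z'" by (auto simp: complete_code_def)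
  \<comment> \<open>\<open>z'\<close> is empty if \<open>X\<close> is. One more letter makes
    \<open>z\<close> nonempty, so that a factorization of \<open>z @ y\<close> over \<open>X\<close>
    has a first code word.\<close>
  obtain v where v: "length v = 1" "z' @ v \<in> S" using S_ext_right[OF z'(1)] by blast
  define z where "z = z' @ v"
  have z: "z \<in> S" "z \<noteq> []" using v by (auto simp: z_def)
  have npc: "\<not> prefix z x" "\<not> prefix x (z @ y)" if "x \<in> X" for x y
    using z'(2) that prefix_same_cases[of x "z @ y" z'] append_prefixD[of z' v x]
    unfolding z_def by (auto simp del: prefix_append)
  obtain V where V: "\<And>w. w \<in> S \<Longrightarrow> z @ V w @ w \<in> S" using S_recurrent[OF z(1)] by metis
  define W where "W = rec_nat z (\<lambda>_ w. z @ V w @ w)"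
  have W_Suc: "W (Suc k) = z @ V (W k) @ W k" for k by (simp add: W_def)
  have W_S: "W k \<in> S" for k by (induction k) (use z V W_Suc in \<open>auto simp: W_def\<close>)
  have W_less: "\<exists>y. W j = (z @ y) @ W i" if "i < j" for i j
    using that
  proof (induction j)
    case (Suc j)
    show ?case
    proof (cases "i = j")
      case True
      then show ?thesis using W_Suc by simp
    next
      case False
      then obtain y where "W j = (z @ y) @ W i" using Suc by auto
      then show ?thesis using W_Suc[of j] by (intro exI[of _ "V (W j) @ z @ y"]) simp
    qed
  qed simp
  have "C (W i) \<noteq> C (W j)" if ij: "i < j" for i j
  proof
    assume eq: "C (W i) = C (W j)"
    obtain y where y: "W j = (z @ y) @ W i" using W_less[OF ij] by blast
    then have zy: "z @ y \<in> S" using W_S[of j] S_prefix[of "z @ y" "W i"] by simp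
    have "E (z @ y) \<in> H"
      by (rule C_eqD[OF S_lists[OF zy] S_lists[OF W_S[of i]]]) (use eq y in simp)
    then have "z @ y \<in> word_star X" using E_in_H[OF zy] by blast
    then obtain x where "x \<in> X" "prefix x (z @ y)" using word_star_prefix z by blast
    then show False using npc by blast
  qed
  then have "inj (\<lambda>i. C (W i))" by (intro linorder_injI) auto
  then have "infinite (range (\<lambda>i. C (W i)))" using finite_imageD infinite_UNIV_nat by blast
  moreover have "range (\<lambda>i. C (W i)) \<subseteq> rcosets\<^bsub>G\<^esub> H"
    using W_S S_lists unfolding rcosets_eq by blast
  ultimately show False using fin finite_subset by blast
qed

section \<open>The cosets met by live suffixes, and the degree\<close>

definition cosets :: "'a list \<Rightarrow> 'a list set set set" where
  "cosets u = C ` live X u"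

lemma live_lists: "u \<in> S \<Longrightarrow> p \<in> live X u \<Longrightarrow> p \<in> lists A"
  using S_lists S_suffix by (fastforce simp: live_def suffix_def)

text \<open>If \<open>q = t @ p\<close> and \<open>p\<close> lie in one coset, then \<open>t\<close>
  is a word of \<open>S\<close> in \<open>H\<close>, hence a product of code words. As
  \<open>q\<close> has no prefix in \<open>X\<close>, \<open>t\<close> is empty.\<close>

lemma inj_on_C: 
  assumes u: "u \<in> S"
  shows "inj_on C (live X u)"
proof -
  have *: "p = q" if p: "p \<in> live X u" and q: "q \<in> live X u" and eq: "C p = C q" and "suffix p q" for p q
  proof -
    obtain t where t: "q = t @ p" using \<open>suffix p q\<close> by (auto simp: suffix_def)
    have "q \<in> S" using q u S_suffix by (auto simp: live_def suffix_def)
    then have tS: "t \<in> S" using t S_prefix by blast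
    have "E t \<in> H" by (rule C_eqD[OF S_lists[OF tS] live_lists[OF u p]]) (use eq t in simp)
    then have "t \<in> word_star X" by (rule E_in_H[OF tS])
    have "t = []"
    proof (rule ccontr)
      assume "t \<noteq> []"
      then obtain x where "x \<in> X" "prefix x t"
        using word_star_prefix[OF \<open>t \<in> word_star X\<close>] by blast
      then show False using q t by (auto simp: live_def)
    qed
    then show ?thesis using t by simp
  qed
  show ?thesis
  proof (rule inj_onI)
    fix p q assume pq: "p \<in> live X u" "q \<in> live X u" "C p = C q"
    then have "suffix p q \<or> suffix q p" unfolding live_def using suffix_same_cases by blast
    then show "p = q" using *[of p q] *[of q p] pq by auto
  qed
qed

lemma card_cosets: "u \<in> S \<Longrightarrow> card (cosets u) = card (live X u)"
  unfolding cosets_def by (rule card_image[OF inj_on_C])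

lemma finite_cosets: "finite (cosets u)"
  unfolding cosets_def by (simp add: finite_live)

lemma H_in_cosets: "C [] \<in> cosets u"
  unfolding cosets_def using Nil_live[OF bifix] by blast

lemma cosets_snoc:
  assumes "u @ [a] \<in> S" "c \<in> cosets u"
  shows "c #>\<^bsub>G\<^esub> E [a] \<in> cosets (u @ [a])"
proof -
  have u: "u \<in> S" "[a] \<in> S" using assms(1) S_prefix S_suffix by blast+
  obtain p where p: "p \<in> live X u" "c = C p" using assms(2) by (auto simp: cosets_def)
  have c: "c #>\<^bsub>G\<^esub> E [a] = C (p @ [a])"
    using C_append[OF live_lists[OF u(1) p(1)] S_lists[OF u(2)]] p by simp
  show ?thesis
  proof (cases "p @ [a] \<in> X")
    case True
    then have "E (p @ [a]) \<in> H" using word_star_Cons[OF True word_star_Nil] by (auto simp: H_def)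
    then have "C (p @ [a]) = C []" using C_absorb[of "p @ [a]" "[]"] X_lists[OF True] by simp
    then show ?thesis using c H_in_cosets by simp
  next
    case False
    then show ?thesis using c live_snoc[OF p(1) False] by (simp add: cosets_def)
  qed
qed

text \<open>Translation by a letter is injective on cosets and maps \<open>cosets u\<close> into
  \<open>cosets (u @ [a])\<close>.\<close>

lemma card_live_snoc:
  assumes "u @ [a] \<in> S"
  shows "card (live X u) \<le> card (live X (u @ [a]))"
proof -
  have u: "u \<in> S" "[a] \<in> S" using assms(1) S_prefix S_suffix by blast+
  have "inj_on (\<lambda>c. c #>\<^bsub>G\<^esub> E [a]) (cosets u)"
  proof (rule inj_onI)
    fix c c' assume "c \<in> cosets u" "c' \<in> cosets u" and eq: "c #>\<^bsub>G\<^esub> E [a] = c' #>\<^bsub>G\<^esub> E [a]"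
    then obtain p q where p: "p \<in> live X u" "c = C p" "q \<in> live X u" "c' = C q"
      by (auto simp: cosets_def)
    then have "C (p @ [a]) = C (q @ [a])"
      using eq C_append live_lists[OF u(1)] S_lists[OF u(2)] by simp
    then show "c = c'" using C_cancel p live_lists[OF u(1)] S_lists[OF u(2)] by blast
  qed
  then have "card (cosets u) \<le> card (cosets (u @ [a]))"
    by (rule card_inj_on_le) (use cosets_snoc[OF assms] finite_cosets in auto)
  then show ?thesis using card_cosets[OF u(1)] card_cosets[OF assms] by simp
qed

lemma card_live_append: "u @ v \<in> S \<Longrightarrow> card (live X u) \<le> card (live X (u @ v))"
proof (induction v rule: rev_induct)
  case (snoc a v)
  then have "u @ v \<in> S" using S_prefix[of "u @ v" "[a]"] by simp
  then show ?case using snoc card_live_snoc[of "u @ v" a] by simp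
qed simp

lemma complete_imp_index_eq_degree:
  assumes complete: "complete_code S X"
  shows "has_degree S X (card (rcosets\<^bsub>G\<^esub> H))"
proof -
  define N where "N = Max (insert 1 (length ` X))"
  have N: "N \<ge> 1" "\<And>x. x \<in> X \<Longrightarrow> length x \<le> N"
    using finite_X unfolding N_def by (auto intro!: Max_ge simp del: Max_insert)
  \<comment> \<open>By completeness a live word is a prefix of a code word.\<close>
  have short: "length p \<le> N" if p: "u \<in> S" "p \<in> live X u" for u p
  proof -
    have "p \<in> S" using p S_suffix by (auto simp: live_def suffix_def)
    then obtain x where "x \<in> X" "prefix p x"
      using complete p(2) unfolding complete_code_def live_def by blast
    then show ?thesis using N(2) prefix_length_le le_trans by blast
  qed
  have live_long: "live X (w @ u) = live X u" if "w @ u \<in> S" "length u \<ge> N" for w u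
    using live_shorter[of _ X w u] live_append[of _ X u w] short[OF that(1)] that(2)
    by (blast intro: order.trans)
  \<comment> \<open>Recurrence leads from \<open>u\<close> to \<open>u'\<close> without losing live
    suffixes, and at the end only the long word \<open>u'\<close> matters.\<close>
  have card_le: "card (live X u) \<le> card (live X u')" if u: "u \<in> S" "u' \<in> S" "length u' \<ge> N" for u u'
  proof -
    obtain v where v: "u @ v @ u' \<in> S" using S_recurrent[OF u(1,2)] by blast
    then show ?thesis using card_live_append[OF v] live_long[of "u @ v" u'] u by simp
  qed
  obtain u\<^sub>0 where u0: "u\<^sub>0 \<in> S" "length u\<^sub>0 = N" using S_ext_left[OF Nil_in_S, of N] by auto
  have card_eq: "card (cosets u) = card (live X u\<^sub>0)" if "u \<in> S" "length u = N" for u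
    using card_le[of u u\<^sub>0] card_le[of u\<^sub>0 u] that u0 card_cosets by (simp add: le_antisym)
  have subset: "cosets u \<subseteq> cosets (word_inv \<theta> v)" if uv: "u @ v \<in> S" "length v = N" for u v
  proof
    fix c assume "c \<in> cosets u"
    then obtain q where q: "q \<in> live X u" "c = C q" by (auto simp: cosets_def)
    show "c \<in> cosets (word_inv \<theta> v)"
    proof (cases "q = []")
      case False
      have "q @ v \<in> S" using q uv S_suffix[of _ "q @ v"] by (auto simp: live_def suffix_def)
      then obtain x where x: "x \<in> X" "prefix (q @ v) x \<or> prefix x (q @ v)"
        using complete unfolding complete_code_def by blast
      \<comment> \<open>\<open>q @ v\<close> is longer than every code word, and \<open>q\<close> is
        live; hence \<open>x = q @ s\<close>, and \<open>C q\<close> is the coset of the inverse of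
        \<open>s\<close>.\<close>
      have "\<not> prefix (q @ v) x"
        using prefix_length_le[of "q @ v" x] N(2)[OF x(1)] uv(2) False by (cases q) auto
      then have "prefix x (q @ v)" using x by blast
      then obtain s where s: "x = q @ s" "prefix s v"
        using q(1) x(1) by (auto simp: live_def prefix_append)
      have lists: "q \<in> lists A" "s \<in> lists A" using X_lists[OF x(1)] s by auto
      have "word_cong A \<theta> (s @ word_inv \<theta> s) []"
        using word_cong_inv[OF inv_\<theta> word_inv_lists[OF inv_\<theta> lists(2)]] lists(2) by simp
      from word_cong.append[OF word_cong.refl[OF lists(1)] this]
      have "C (q @ s @ word_inv \<theta> s) = C q" unfolding C_def by (simp add: elt_eqI)
      moreover have "E x \<in> H" using word_star_Cons[OF x(1) word_star_Nil] by (auto simp: H_def)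
      ultimately have "C q = C (word_inv \<theta> s)"
        using C_absorb[OF X_lists[OF x(1)] word_inv_lists[OF inv_\<theta> lists(2)]] s by simp
      moreover have "word_inv \<theta> s \<in> live X (word_inv \<theta> v)"
        unfolding live_def
      proof (intro CollectI conjI ballI notI)
        show "suffix (word_inv \<theta> s) (word_inv \<theta> v)" by (rule suffix_word_inv[OF s(2)])
        \<comment> \<open>The inverse of \<open>y\<close> would be a code word and a proper suffix
          of \<open>x\<close>.\<close>
        fix y assume y: "y \<in> X" "prefix y (word_inv \<theta> s)"
        then have "suffix (word_inv \<theta> y) s" using suffix_word_inv[OF y(2), of \<theta>] lists by simp
        then have "strict_suffix (word_inv \<theta> y) x"
          using s(1) False by (auto simp: strict_suffix_def suffix_def)
        then show False using bifix X_inv[OF y(1)] x(1) unfolding bifix_code_def by blast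
      qed
      ultimately show ?thesis using q(2) by (auto simp: cosets_def)
    qed (use q H_in_cosets in auto)
  qed
  \<comment> \<open>Equal cardinalities turn the inclusion into an equality.\<close>
  have edge: "cosets u = cosets (word_inv \<theta> v)" if "(u, v) \<in> gext S N N []" for u v
  proof (rule card_subset_eq[OF finite_cosets])
    have uv: "length u = N" "length v = N" "u @ v \<in> S" using that by (auto simp: gext_def)
    then show "cosets u \<subseteq> cosets (word_inv \<theta> v)" using subset by blast
    have "u \<in> S" "word_inv \<theta> v \<in> S" "length (word_inv \<theta> v) = N"
      using uv S_prefix[of u v] S_inv[OF S_suffix[of u v]] by (auto simp: word_inv_def)
    then show "card (cosets u) = card (cosets (word_inv \<theta> v))" using card_eq uv by simp
  qed
  from gext_const[OF Nil_in_S N(1), of cosets "\<lambda>v. cosets (word_inv \<theta> v)", OF edge] obtain k where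
    k: "\<And>u v. (u, v) \<in> gext S N N [] \<Longrightarrow> cosets u = k (tyR (hd v))" by auto
  have k_inv: "cosets (word_inv \<theta> v) = k (tyR (hd v))" if v: "v \<in> S" "length v = N" for v
  proof -
    obtain u where "length u = N" "u @ v \<in> S" using S_ext_left[OF v(1)] by blast
    then show ?thesis using k[of u v] edge[of u v] v by (simp add: gext_def)
  qed
  have k_last: "cosets u = k (tyL (last u))" if u: "u \<in> S" "length u = N" for u
  proof -
    obtain v where v: "length v = N" "u @ v \<in> S" using S_ext_right[OF u(1)] by blast
    obtain u' b where u': "u = u' @ [b]" using u N(1) by (cases u rule: rev_cases) auto
    obtain c v' where v': "v = c # v'" using v N(1) by (cases v) auto
    have "[b, c] \<in> S" using v(2) S_factor[of u' "[b, c]" v'] u' v' by simp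
    then show ?thesis using k[of u v] u v u' v' tyL_eq_tyR[of b c] by (simp add: gext_def)
  qed
  \<comment> \<open>Seen as a left window, \<open>u\<^sub>0\<close> has the type of its last letter;
    seen as the inverse of a right window, it has the opposite type by
    \<open>tyR_\<theta>\<close>.\<close>
  have k_const: "k True = k False"
  proof -
    have ne: "u\<^sub>0 \<noteq> []" using u0 N(1) by auto
    have uA: "u\<^sub>0 \<in> lists A" by (rule S_lists[OF u0(1)])
    then have last: "last u\<^sub>0 \<in> A" using ne by (cases u\<^sub>0 rule: rev_cases) auto
    have "length (word_inv \<theta> u\<^sub>0) = N" using u0(2) by (simp add: word_inv_def)
    from k_inv[OF S_inv[OF u0(1)] this] have "cosets u\<^sub>0 = k (tyR (hd (word_inv \<theta> u\<^sub>0)))"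
      using uA by simp
    also have "hd (word_inv \<theta> u\<^sub>0) = \<theta> (last u\<^sub>0)" using ne by (simp add: word_inv_def hd_rev last_map)
    finally have "k (tyL (last u\<^sub>0)) = k (\<not> tyL (last u\<^sub>0))"
      using tyR_\<theta>[OF last] k_last[OF u0] by simp
    then show ?thesis by (cases "tyL (last u\<^sub>0)") auto
  qed
  then have const: "cosets u = cosets u\<^sub>0" if "u \<in> S" "length u = N" for u
    using k_last[OF that] k_last[OF u0] by (cases "tyL (last u)"; cases "tyL (last u\<^sub>0)") auto
  have step: "c #>\<^bsub>G\<^esub> E [a] \<in> cosets u\<^sub>0" if c: "c \<in> cosets u\<^sub>0" "a \<in> A" for c a
  proof -
    \<comment> \<open>All windows have the same cosets, so one that \<open>a\<close> can follow may
      be taken; dropping its first letter afterwards gives a window again.\<close>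
    obtain u where u: "length u = N" "u @ [a] \<in> S" using S_ext_left[OF S_letter[OF c(2)]] by blast
    have "u \<noteq> []" using u N(1) by auto
    then obtain b u' where u': "u = b # u'" by (cases u) auto
    have S: "u \<in> S" "u' @ [a] \<in> S" using u(2) S_prefix S_suffix[of "[b]" "u' @ [a]"] u' by auto
    have "c #>\<^bsub>G\<^esub> E [a] \<in> cosets (u @ [a])" using cosets_snoc[OF u(2)] const[OF S(1) u(1)] c by simp
    also have "cosets (u @ [a]) = cosets (u' @ [a])"
      using live_long[of "[b]" "u' @ [a]"] u u' by (simp add: cosets_def)
    also have "\<dots> = cosets u\<^sub>0" using const[OF S(2)] u u' by simp
    finally show ?thesis .
  qed
  have "C w \<in> cosets u\<^sub>0" if "w \<in> lists A" for w
    using that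
  proof (induction w rule: rev_induct)
    case Nil
    show ?case by (rule H_in_cosets)
  next
    case (snoc a w)
    then show ?case using step[of "C w" a] C_append[of w "[a]"] by simp
  qed
  moreover have "cosets u\<^sub>0 \<subseteq> C ` lists A" using live_lists[OF u0(1)] by (auto simp: cosets_def)
  ultimately have "rcosets\<^bsub>G\<^esub> H = cosets u\<^sub>0" unfolding rcosets_eq by blast
  then have index: "card (rcosets\<^bsub>G\<^esub> H) = card (live X u\<^sub>0)" using card_cosets[OF u0(1)] by simp
  show ?thesis
    unfolding has_degree_def card_parses[OF bifix] index
    using card_le[OF _ u0(1)] u0 by auto
qed

end

theorem theorem8p1:
  fixes A :: "'a set" and \<theta> :: "'a \<Rightarrow> 'a" and S X :: "'a list set" and d :: nat
  assumes "finite A" and "involution_on A \<theta>"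
    and "specular A \<theta> S" and "recurrent_set A S"
    and "X \<subseteq> S" and "finite X" and "symmetric_words \<theta> X" and "bifix_code X"
    and "d \<ge> 1"
  shows "maximal_bifix_code S X \<and> has_degree S X d \<longleftrightarrow>
    (\<exists>H. subgroup H (G_theta A \<theta>) \<and> card (rcosets\<^bsub>G_theta A \<theta>\<^esub> H) = d \<and>
         monoidal_basis (G_theta A \<theta>) H (elt A \<theta> ` X))"
proof -
  interpret specular_code A \<theta> S X
    using assms by unfold_locales
  \<comment> \<open>\<open>H\<close> always has the basis in question and is the only candidate, so
    its index is all that matters.\<close>
  have "maximal_bifix_code S X \<and> has_degree S X d \<longleftrightarrow> card (rcosets\<^bsub>G\<^esub> H) = d"
  proof
    assume "maximal_bifix_code S X \<and> has_degree S X d"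
    then show "card (rcosets\<^bsub>G\<^esub> H) = d"
      using complete_imp_index_eq_degree[OF maximal_imp_complete] has_degree_unique by blast
  next
    assume d: "card (rcosets\<^bsub>G\<^esub> H) = d"
    \<comment> \<open>An infinite index would have \<open>card\<close> equal to 0, contrary to
      \<open>d \<ge> 1\<close>.\<close>
    then have "finite (rcosets\<^bsub>G\<^esub> H)" using assms(9) card.infinite by fastforce
    from finite_index_imp_complete[OF this]
    show "maximal_bifix_code S X \<and> has_degree S X d"
      using complete_imp_maximal complete_imp_index_eq_degree d by blast
  qed
  then show ?thesis using subgroup_H monoidal_basis_H monoidal_basis_imp_eq_H by metis
qed

end
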